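(* Let $p$ be a prime and let $G$ be a finite non-abelian $p$-group with $d(Z(G)\cap G') = d(Z(G))$. Let $X_G\subset \mathrm{Irr}(G)$ be a minimal faithful quasi-permutation representation of $G$. Then $X_G\cap \mathrm{lin}(G)=\emptyset$, and $p^{s+1}$ divides $c(G)$, where $p^s=\min\{\chi(1) \mid \chi\in \mathrm{nl}(G)\}$.
   Context: For a finite group $H$, $d(H)$ denotes the minimal number of generators of $H$; $Z(G)$ is the center and $G'$ the commutator subgroup of $G$. $\mathrm{Irr}(G)$, $\mathrm{lin}(G)$ and $\mathrm{nl}(G)$ denote respectively the set of irreducible complex characters, the set of linear characters, and the set of nonlinear irreducible complex characters of $G$. A quasi-permutation matrix is a square matrix over $\mathbb{C}$ with non-negative integral trace. $c(G)$ denotes the minimal degree of a faithful representation of $G$ by complex quasi-permutation matrices, i.e. the least $n$ such that there is an injective homomorphism $G\to \mathrm{GL}_n(\mathbb{C})$ all of whose image elements have non-negative integer trace. For $\chi\in\mathrm{Irr}(G)$, $\mathbb{Q}(\chi)$ is the field obtained by adjoining all values $\chi(g)$, $g\in G$, to $\mathbb{Q}$, and $\Gamma(\chi)$ is the Galois group of $\mathbb{Q}(\chi)$ over $\mathbb{Q}$. For $X\subset\mathrm{Irr}(G)$ put $\xi_X=\sum_{\chi\in X}\sum_{\sigma\in\Gamma(\chi)}\chi^\sigma$, and let $m(\xi_X)$ be the absolute value of the minimum value that $\xi_X$ takes over $G$. A set $X_G\subset \mathrm{Irr}(G)$ is called a minimal faithful quasi-permutation representation of $G$ if $\bigcap_{\chi\in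 X_G}\ker(\chi)=1$, $\bigcap_{\chi\in Y}\ker(\chi)\neq 1$ for every proper subset $Y$ of $X_G$, and $c(G)=\xi_{X_G}(1)+m(\xi_{X_G})$. *)

theory Defs
  imports
    "HOL-Algebra.Algebra"
    "HOL-Computational_Algebra.Primes"
    "Jordan_Normal_Form.VS_Connect"
begin

section \<open>Groups\<close>

definition group_center :: "('a, 'b) monoid_scheme \<Rightarrow> 'a set" where
  "group_center G = {z \<in> carrier G. \<forall>g \<in> carrier G. z \<otimes>\<^bsub>G\<^esub> g = g \<otimes>\<^bsub>G\<^esub> z}"

definition min_generators :: "('a, 'b) monoid_scheme \<Rightarrow> nat" where
  "min_generators H =
     (LEAST n. \<exists>S \<subseteq> carrier H. finite S \<and> card S = n \<and> generate H S = carrier H)"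


section \<open>Complex representations and characters\<close>

definition GL :: "nat \<Rightarrow> complex mat monoid" where
  "GL n = units_of (ring_mat TYPE(complex) n ())"

definition mat_trace :: "complex mat \<Rightarrow> complex" where
  "mat_trace A = (\<Sum>i < dim_row A. A $$ (i, i))"

definition irreducible_rep ::
    "('a, 'b) monoid_scheme \<Rightarrow> nat \<Rightarrow> ('a \<Rightarrow> complex mat) \<Rightarrow> bool" where
  "irreducible_rep G n \<rho> \<longleftrightarrow>
     \<rho> \<in> hom G (GL n) \<and> n > 0 \<and>
     (\<forall>W. VectorSpace.subspace class_ring W (module_vec TYPE(complex) n) \<longrightarrow>
          (\<forall>g \<in> carrier G. \<forall>w \<in> W. \<rho> g *\<^sub>v w \<in> W) \<longrightarrow>
          W = {0\<^sub>v n} \<or> W = carrier_vec n)"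

text \<open>Characters are \<^const>\<open>undefined\<close> outside the carrier, so that two characters
  agreeing on the group are equal.\<close>

definition character :: "('a, 'b) monoid_scheme \<Rightarrow> ('a \<Rightarrow> complex mat) \<Rightarrow> 'a \<Rightarrow> complex" where
  "character G \<rho> = (\<lambda>g \<in> carrier G. mat_trace (\<rho> g))"

definition Irr :: "('a, 'b) monoid_scheme \<Rightarrow> ('a \<Rightarrow> complex) set" where
  "Irr G = {\<chi>. \<exists>n \<rho>. irreducible_rep G n \<rho> \<and> \<chi> = character G \<rho>}"

definition lin :: "('a, 'b) monoid_scheme \<Rightarrow> ('a \<Rightarrow> complex) set" where
  "lin G = {\<chi> \<in> Irr G. \<chi> \<one>\<^bsub>G\<^esub> = 1}"

definition nl :: "('a, 'b) monoid_scheme \<Rightarrow> ('a \<Rightarrow> complex) set" where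
  "nl G = {\<chi> \<in> Irr G. \<chi> \<one>\<^bsub>G\<^esub> \<noteq> 1}"

definition char_kernel :: "('a, 'b) monoid_scheme \<Rightarrow> ('a \<Rightarrow> complex) \<Rightarrow> 'a set" where
  "char_kernel G \<chi> = {g \<in> carrier G. \<chi> g = \<chi> \<one>\<^bsub>G\<^esub>}"

text \<open>The intersection over the empty set of characters is the whole group.\<close>

definition common_kernel :: "('a, 'b) monoid_scheme \<Rightarrow> ('a \<Rightarrow> complex) set \<Rightarrow> 'a set" where
  "common_kernel G XG = carrier G \<inter> \<Inter>(char_kernel G ` XG)"


section \<open>Quasi-permutation representations\<close>

definition quasi_permutation :: "complex mat \<Rightarrow> bool" where
  "quasi_permutation A \<longleftrightarrow> square_mat A \<and> mat_trace A \<in> \<nat>"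

definition min_quasi_perm_degree :: "('a, 'b) monoid_scheme \<Rightarrow> nat" where
  "min_quasi_perm_degree G =
     (LEAST n. \<exists>\<rho> \<in> hom G (GL n). inj_on \<rho> (carrier G) \<and>
        (\<forall>g \<in> carrier G. quasi_permutation (\<rho> g)))"

definition char_field :: "('a, 'b) monoid_scheme \<Rightarrow> ('a \<Rightarrow> complex) \<Rightarrow> complex set" where
  "char_field G \<chi> = generate_field class_ring (\<rat> \<union> \<chi> ` carrier G)"

text \<open>Automorphisms are taken to be \<^const>\<open>undefined\<close> outside the field, so that
  the Galois group contains each automorphism exactly once.\<close>

definition char_galois :: "('a, 'b) monoid_scheme \<Rightarrow> ('a \<Rightarrow> complex) \<Rightarrow> (complex \<Rightarrow> complex) set" where
  "char_galois G \<chi> =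
     (let K = class_ring\<lparr>carrier := char_field G \<chi>\<rparr> in
      {\<sigma> \<in> ring_iso K K \<inter> extensional (carrier K). \<forall>q \<in> \<rat>. \<sigma> q = q})"

definition xi :: "('a, 'b) monoid_scheme \<Rightarrow> ('a \<Rightarrow> complex) set \<Rightarrow> 'a \<Rightarrow> complex" where
  "xi G XG g = (\<Sum>\<chi> \<in> XG. \<Sum>\<sigma> \<in> char_galois G \<chi>. \<sigma> (\<chi> g))"

text \<open>\<^const>\<open>xi\<close> takes rational (indeed integer) values on the group, so passing
  to real parts only changes the type.\<close>

definition xi_min :: "('a, 'b) monoid_scheme \<Rightarrow> ('a \<Rightarrow> complex) set \<Rightarrow> real" where
  "xi_min G XG = \<bar>Min ((\<lambda>g. Re (xi G XG g)) ` carrier G)\<bar>"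

definition min_faithful_quasi_perm ::
    "('a, 'b) monoid_scheme \<Rightarrow> ('a \<Rightarrow> complex) set \<Rightarrow> bool" where
  "min_faithful_quasi_perm G XG \<longleftrightarrow>
     XG \<subseteq> Irr G \<and>
     common_kernel G XG = {\<one>\<^bsub>G\<^esub>} \<and>
     (\<forall>Y. Y \<subset> XG \<longrightarrow> common_kernel G Y \<noteq> {\<one>\<^bsub>G\<^esub>}) \<and>
     of_nat (min_quasi_perm_degree G) = xi G XG \<one>\<^bsub>G\<^esub> + of_real (xi_min G XG)"

end

theory Submission
  imports Defs "Berlekamp_Zassenhaus.Factor_Bound" "Jordan_Normal_Form.Spectral_Radius"
begin

text \<open>Write \<open>Z\<close> for the centre of \<open>G\<close> and \<open>\<Omega>\<close> for the elements of \<open>Z\<close> whose \<open>p\<close>-th power is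
  trivial.  An abelian \<open>p\<close>-group \<open>A\<close> has \<open>p ^ d(A)\<close> elements with trivial \<open>p\<close>-th power, so the
  hypothesis on numbers of generators forces \<open>\<Omega> \<subseteq> G'\<close>
  (\<open>central_torsion_subset_derived\<close>).

  A nontrivial normal subgroup of a \<open>p\<close>-group contains a nontrivial element of \<open>\<Omega>\<close>.  Hence a set
  of characters is faithful as soon as no nontrivial element of \<open>\<Omega>\<close> lies in all its kernels.
  A linear character has \<open>G'\<close>, and so \<open>\<Omega>\<close>, in its kernel; removing it from a faithful
  set leaves a faithful set, so a minimal faithful set contains no linear character.

  For the divisibility, minimality yields for each \<open>\<chi>\<close> in the set an element of \<open>\<Omega>\<close> outside the
  kernel of \<open>\<chi>\<close> and inside all the others; the product of these is one \<open>z \<in> \<Omega>\<close> outside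
  every kernel (\<open>separating_central_element\<close>).  By Schur's lemma \<open>z\<close> acts as a primitive \<open>p\<close>-th
  root of unity \<open>\<omega>\<close> in the representation of \<open>\<chi>\<close>.  The sum of the Galois conjugates of \<open>\<chi>(g)\<close> is
  \<open>|\<Gamma>|\<close> times the mean of \<open>\<chi>(g ^ u)\<close> over the residues \<open>u\<close> prime to \<open>p\<close>
  (\<open>galois_orbit_sum\<close>), because \<open>\<chi>(g) \<mapsto> \<chi>(g ^ u)\<close> extends to an automorphism of
  \<open>\<rat>(\<chi>)\<close>; this rests on the irreducibility of the cyclotomic polynomials of prime power order.
  Each eigenvalue of \<open>g\<close> contributes \<open>1\<close>, \<open>0\<close> or \<open>-1 / (p - 1)\<close> to that mean.  So the sum is at
  least \<open>-\<chi>(1) |\<Gamma>| / (p - 1)\<close>, and \<open>z\<close> attains this bound for all the characters at once.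
  Therefore \<open>m(\<xi>) = \<xi>(1) / (p - 1)\<close> and
    \<open>c(G) = p * (\<Sum>\<chi>. \<chi>(1) * (|\<Gamma>(\<chi>)| / (p - 1)))\<close>.
  Here \<open>p - 1\<close> divides \<open>|\<Gamma>(\<chi>)|\<close> since \<open>\<omega> \<in> \<rat>(\<chi>)\<close>
  (\<open>prime_minus_one_dvd_card_char_galois\<close>).  Finally \<open>\<chi>(1)\<close> divides the order of \<open>G\<close>
  (\<open>degree_dvd_order\<close>), so the degrees are powers of \<open>p\<close> and the least nonlinear one divides all
  the nonlinear ones.\<close>

section \<open>Eisenstein and the cyclotomic polynomial of prime power order\<close>

text \<open>One factor has a constant term divisible by \<open>p\<close>, and then the other has not.  The
  lowest coefficient of the first factor that is prime to \<open>p\<close> produces a coefficient of the product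
  that is prime to \<open>p\<close>; by hypothesis this can only be the leading one, so the first factor already
  has full degree.\<close>

lemma eisenstein_degree:
  fixes g h :: "int Polynomial.poly" and p :: int
  assumes p: "Factorial_Ring.prime p"
    and low: "\<And>i. i < Polynomial.degree (g * h) \<Longrightarrow> p dvd Polynomial.coeff (g * h) i"
    and lead: "\<not> p dvd Polynomial.lead_coeff (g * h)"
    and const: "\<not> p\<^sup>2 dvd Polynomial.coeff (g * h) 0"
  shows "Polynomial.degree g = 0 \<or> Polynomial.degree h = 0"
proof -
  have key: "Polynomial.degree b = 0"
    if ab: "a * b = g * h" and a0: "p dvd Polynomial.coeff a 0" for a b :: "int Polynomial.poly"
  proof -
    have nz: "a \<noteq> 0" "b \<noteq> 0" using lead ab by auto
    have b0: "\<not> p dvd Polynomial.coeff b 0"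
    proof
      assume "p dvd Polynomial.coeff b 0"
      with a0 have "p * p dvd Polynomial.coeff a 0 * Polynomial.coeff b 0" by (rule mult_dvd_mono)
      then show False using const by (simp add: ab[symmetric] coeff_mult_0 power2_eq_square)
    qed
    have la: "\<not> p dvd Polynomial.lead_coeff a"
      using lead by (auto simp: ab[symmetric] lead_coeff_mult)
    define i where "i = (LEAST i. \<not> p dvd Polynomial.coeff a i)"
    have i: "\<not> p dvd Polynomial.coeff a i" "i \<le> Polynomial.degree a"
      unfolding i_def using la by (rule LeastI, rule Least_le)
    have small: "p dvd Polynomial.coeff a j" if "j < i" for j
      using that not_less_Least unfolding i_def by blast
    have "Polynomial.coeff (a * b) i =
        (\<Sum>j\<in>{..<i}. Polynomial.coeff a j * Polynomial.coeff b (i - j)) + Polynomial.coeff a i * Polynomial.coeff b 0"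
      by (simp add: coeff_mult lessThan_Suc_atMost[symmetric])
    moreover have "p dvd (\<Sum>j\<in>{..<i}. Polynomial.coeff a j * Polynomial.coeff b (i - j))"
      by (intro dvd_sum) (simp add: small)
    moreover have "\<not> p dvd Polynomial.coeff a i * Polynomial.coeff b 0"
      using i b0 p by (simp add: prime_dvd_mult_iff)
    ultimately have "\<not> p dvd Polynomial.coeff (a * b) i"
      by (simp add: dvd_add_right_iff)
    with low have "\<not> i < Polynomial.degree (a * b)" by (auto simp: ab)
    with i nz show ?thesis by (simp add: degree_mult_eq)
  qed
  show ?thesis
  proof (cases "Polynomial.degree (g * h) = 0")
    case True
    with lead show ?thesis by (metis add_is_0 degree_0 degree_mult_eq)
  next
    case False
    then have "p dvd Polynomial.coeff g 0 * Polynomial.coeff h 0"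
      using low[of 0] by (simp add: coeff_mult_0)
    then have "p dvd Polynomial.coeff g 0 \<or> p dvd Polynomial.coeff h 0"
      using p by (simp add: prime_dvd_mult_iff)
    then show ?thesis using key[of g h] key[of h g] by (auto simp: mult.commute)
  qed
qed

lemma prime_dvd_freshman:
  fixes x y :: "'a :: comm_ring_1"
  assumes "Factorial_Ring.prime (p :: nat)"
  shows "of_nat p dvd (x + y) ^ p - x ^ p - y ^ p"
proof -
  have p: "p > 0" using assms by (simp add: prime_gt_0_nat)
  have "(x + y) ^ p = (\<Sum>k\<le>p. of_nat (p choose k) * x ^ k * y ^ (p - k))"
    by (rule binomial_ring)
  also have "\<dots> = (\<Sum>k\<in>{0<..<p}. of_nat (p choose k) * x ^ k * y ^ (p - k)) + (x ^ p + y ^ p)"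
  proof -
    have "{..p} = insert 0 (insert p {0<..<p})" using p by auto
    then show ?thesis using p by (simp add: add_ac)
  qed
  finally have "(x + y) ^ p - x ^ p - y ^ p = (\<Sum>k\<in>{0<..<p}. of_nat (p choose k) * x ^ k * y ^ (p - k))"
    by simp
  moreover have "of_nat p dvd (\<Sum>k\<in>{0<..<p}. of_nat (p choose k) * x ^ k * y ^ (p - k))"
  proof (rule dvd_sum)
    fix k assume "k \<in> {0<..<p}"
    then have "p dvd (p choose k)" using assms by (intro dvd_choose_prime) auto
    then have "(of_nat p :: 'a) dvd of_nat (p choose k)" by (metis dvdE dvd_triv_left of_nat_mult)
    then show "(of_nat p :: 'a) dvd of_nat (p choose k) * x ^ k * y ^ (p - k)"
      by (simp add: dvd_mult2)
  qed
  ultimately show ?thesis by simp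
qed

text \<open>Iterates the congruence \<open>(x + y) ^ p = x ^ p + y ^ p\<close> modulo \<open>p\<close>.  It is stated by divisibility in
  the ring itself, so that it applies to integer polynomials without passing to a ring of
  characteristic \<open>p\<close>.\<close>

lemma prime_dvd_freshman_add_one:
  fixes x :: "'a :: comm_ring_1"
  assumes p: "Factorial_Ring.prime (p :: nat)"
  shows "of_nat p dvd (x + 1) ^ (p ^ j) - x ^ (p ^ j) - 1"
proof (induction j)
  case 0
  then show ?case by simp
next
  case (Suc j)
  let ?u = "(x + 1) ^ (p ^ j)" and ?v = "x ^ (p ^ j) + 1"
  have "of_nat p dvd ?u - ?v" using Suc by (simp add: algebra_simps)
  moreover have "?u - ?v dvd ?u ^ p - ?v ^ p"
    by (simp add: power_diff_sumr2)
  ultimately have "of_nat p dvd ?u ^ p - ?v ^ p" by (rule dvd_trans)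
  moreover have "of_nat p dvd ?v ^ p - (x ^ (p ^ j)) ^ p - 1 ^ p"
    by (rule prime_dvd_freshman[OF p])
  ultimately have "of_nat p dvd (?u ^ p - ?v ^ p) + (?v ^ p - (x ^ (p ^ j)) ^ p - 1 ^ p)"
    by (rule dvd_add)
  then show ?case by (simp add: power_mult[symmetric] mult.commute algebra_simps)
qed

text \<open>The cyclotomic polynomial of order \<open>p ^ (j + 1)\<close>, namely \<open>(x ^ (p * q) - 1) / (x ^ q - 1)\<close> for
  \<open>q = p ^ j\<close>.\<close>

definition cyclotomic_prime_power :: "nat \<Rightarrow> nat \<Rightarrow> int Polynomial.poly" where
  "cyclotomic_prime_power p j = (\<Sum>i<p. (Polynomial.monom 1 (p ^ j)) ^ i)"

text \<open>Substituting \<open>x + 1\<close> for \<open>x\<close> makes the polynomial Eisenstein.  The quotient formula becomes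
  \<open>((x + 1) ^ q - 1) * f = (x + 1) ^ (p * q) - 1\<close>, and modulo \<open>p\<close> this reads
  \<open>x ^ q * f = x ^ (p * q)\<close>.\<close>

lemma shifted_cyclotomic:
  fixes p j i :: nat
  assumes p: "Factorial_Ring.prime (p :: nat)"
  defines "f \<equiv> pcompose (cyclotomic_prime_power p j) [:1, 1:]"
  defines "N \<equiv> p ^ j * (p - 1)"
  shows "int p dvd Polynomial.coeff (f - Polynomial.monom 1 N) i"
    and "Polynomial.degree f = N" and "Polynomial.lead_coeff f = 1" and "Polynomial.coeff f 0 = int p"
proof -
  let ?q = "p ^ j"
  define Y :: "int Polynomial.poly" where "Y = [:0, 1:]"
  have X1: "[:1, 1:] = Y + 1" 
    unfolding Y_def by (rule poly_eqI) (auto simp: coeff_pCons split: nat.splits)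
  have mon: "Polynomial.monom 1 k = Y ^ k" for k
    by (simp only: Y_def monom_altdef smult_1_left)
  have Xc: "pcompose Y [:1, 1:] = Y + 1" unfolding X1[symmetric] by (simp add: Y_def pcompose_pCons)
  have f: "f = (\<Sum>i<p. ((Y + 1) ^ ?q) ^ i)"
    unfolding f_def cyclotomic_prime_power_def
    by (simp add: pcompose_sum pcompose_hom.hom_power mon Xc[simplified])
  have tele: "((Y + 1) ^ ?q - 1) * f = (Y + 1) ^ (p ^ Suc j) - 1"
    unfolding f power_diff_1_eq[symmetric] by (simp add: power_mult[symmetric] mult.commute)
  show "int p dvd Polynomial.coeff (f - Polynomial.monom 1 N) i"
  proof -
    obtain r where r: "(Y + 1) ^ ?q - Y ^ ?q - 1 = of_nat p * r"
      using prime_dvd_freshman_add_one[OF p, of Y j] by (rule dvdE)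
    obtain s where s: "(Y + 1) ^ (p ^ Suc j) - Y ^ (p ^ Suc j) - 1 = of_nat p * s"
      using prime_dvd_freshman_add_one[OF p, of Y "Suc j"] by (rule dvdE)
    have e: "p ^ Suc j = ?q + N" using p by (simp add: N_def algebra_simps prime_gt_0_nat Suc_leI)
    have "Y ^ ?q * (f - Y ^ N) = (((Y + 1) ^ ?q - 1) * f - of_nat p * r * f) - Y ^ (p ^ Suc j)"
      using r unfolding e power_add by (simp add: algebra_simps)
    also have "\<dots> = of_nat p * (s - r * f)"
      unfolding tele using s by (simp add: algebra_simps)
    finally have "Y ^ ?q * (f - Y ^ N) = of_nat p * (s - r * f)" .
    then have "Polynomial.coeff (Polynomial.monom 1 ?q * (f - Y ^ N)) (i + ?q) = Polynomial.coeff (of_nat p * (s - r * f)) (i + ?q)"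
      by (simp add: mon)
    then have "Polynomial.coeff (f - Y ^ N) i = int p * Polynomial.coeff (s - r * f) (i + ?q)"
      by (simp add: coeff_monom_mult of_nat_poly)
    then show ?thesis by (simp add: mon)
  qed
  have monic: "Polynomial.lead_coeff (Y + 1) = 1" "Polynomial.degree (Y + 1) = 1"
    by (simp_all add: X1[symmetric])
  have lc: "Polynomial.lead_coeff ((Y + 1) ^ k) = 1" for k
    using monic by (simp add: lead_coeff_power)
  have dg: "Polynomial.degree ((Y + 1) ^ k) = k" for k
    using monic by (subst degree_power_eq) auto
  have ge: "Polynomial.degree ((Y + 1) ^ k - 1) = k" "Polynomial.lead_coeff ((Y + 1) ^ k - 1) = 1" if "k > 0" for k
  proof -
    have "Polynomial.degree (1 :: int Polynomial.poly) < Polynomial.degree ((Y + 1) ^ k)" using that dg by simp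
    then show "Polynomial.degree ((Y + 1) ^ k - 1) = k" "Polynomial.lead_coeff ((Y + 1) ^ k - 1) = 1"
      using dg[of k] lc[of k] degree_add_eq_left[of "- 1" "(Y + 1) ^ k"] by (auto simp: coeff_eq_0)
  qed
  have q0: "?q > 0" "p ^ Suc j > 0" using p by (auto simp: prime_gt_0_nat)
  have nz: "f \<noteq> 0" "(Y + 1) ^ ?q - 1 \<noteq> 0"
    using tele ge(1)[OF q0(2)] q0 by auto
  have "?q + Polynomial.degree f = p ^ Suc j"
    using arg_cong[OF tele, of Polynomial.degree] degree_mult_eq[OF nz(2,1)] ge(1)[OF q0(1)] ge(1)[OF q0(2)] by simp
  then show "Polynomial.degree f = N" using p by (simp add: N_def algebra_simps diff_mult_distrib2)
  show "Polynomial.lead_coeff f = 1"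
    using arg_cong[OF tele, of Polynomial.lead_coeff] ge(2)[OF q0(1)] ge(2)[OF q0(2)]
    by (simp only: lead_coeff_mult)
  show "Polynomial.coeff f 0 = int p"
    unfolding f by (simp add: Y_def poly_0_coeff_0[symmetric] poly_sum)
qed

text \<open>By Gauss's lemma a rational factorisation has an integral one of the same degrees, to which
  Eisenstein's criterion applies after the shift.\<close>

lemma irreducible_cyclotomic_prime_power:
  assumes p: "Factorial_Ring.prime (p :: nat)" and fac: "map_poly rat_of_int (cyclotomic_prime_power p j) = g * h"
  shows "Polynomial.degree g = 0 \<or> Polynomial.degree h = 0"
proof -
  let ?s = "\<lambda>f :: int Polynomial.poly. pcompose f [:1, 1:]"
  obtain g' h' where gh: "cyclotomic_prime_power p j = g' * h'"
      and deg: "Polynomial.degree g' = Polynomial.degree g" "Polynomial.degree h' = Polynomial.degree h"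
    using rat_to_int_factor[OF fac] by blast
  note sh = shifted_cyclotomic[OF p, of j]
  have eq: "?s (cyclotomic_prime_power p j) = ?s g' * ?s h'" by (simp add: gh pcompose_mult)
  have p1: "p > 1" using p by (rule prime_gt_1_nat)
  have "Polynomial.degree (?s g') = 0 \<or> Polynomial.degree (?s h') = 0"
  proof (rule eisenstein_degree[of "int p"])
    show "Factorial_Ring.prime (int p)" using p by simp
    show "int p dvd Polynomial.coeff (?s g' * ?s h') i" if "i < Polynomial.degree (?s g' * ?s h')" for i
    proof -
      have "i < p ^ j * (p - 1)" using that sh(2) unfolding eq by simp
      then show ?thesis using sh(1)[of i] unfolding eq by (simp only: coeff_diff coeff_monom) simp
    qed
    show "\<not> int p dvd Polynomial.lead_coeff (?s g' * ?s h')"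
      using sh(3) p1 unfolding eq by simp
    show "\<not> (int p)\<^sup>2 dvd Polynomial.coeff (?s g' * ?s h') 0"
    proof
      assume "(int p)\<^sup>2 dvd Polynomial.coeff (?s g' * ?s h') 0"
      then have "(int p)\<^sup>2 dvd int p * 1" using sh(4) unfolding eq by simp
      then have "int p dvd 1" using p1 unfolding power2_eq_square by (subst (asm) dvd_times_left_cancel_iff) auto
      then show False using p1 by simp
    qed
  qed
  then show ?thesis using deg by (simp add: degree_pcompose)
qed

section \<open>Conjugation in cyclotomic fields of prime power order\<close>

definition qeval :: "rat Polynomial.poly \<Rightarrow> complex \<Rightarrow> complex" where
  "qeval f x = poly (map_poly of_rat f) x"

lemma qeval_simps [simp]:
  "qeval (f + g) x = qeval f x + qeval g x"
  "qeval (f * g) x = qeval f x * qeval g x"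
  "qeval (- f) x = - qeval f x" "qeval (f - g) x = qeval f x - qeval g x"
  "qeval 0 x = 0" "qeval 1 x = 1" "qeval [:c:] x = of_rat c"
  "qeval (Polynomial.monom 1 i) x = x ^ i"
proof -
  interpret h: map_poly_idom_hom "of_rat :: rat \<Rightarrow> complex" ..
  show "qeval (f + g) x = qeval f x + qeval g x"
    "qeval (f * g) x = qeval f x * qeval g x"
    "qeval (- f) x = - qeval f x" "qeval (f - g) x = qeval f x - qeval g x"
    "qeval 0 x = 0" "qeval 1 x = 1" "qeval [:c:] x = of_rat c"
    "qeval (Polynomial.monom 1 i) x = x ^ i"
    by (simp_all add: qeval_def hom_distribs map_poly_monom poly_monom)
qed

lemma qeval_sum [simp]: "qeval (sum f A) x = (\<Sum>i\<in>A. qeval (f i) x)"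
  by (induction A rule: infinite_finite_induct) auto

lemma qeval_power [simp]: "qeval (f ^ i) x = qeval f x ^ i"
  by (induction i) auto

text \<open>The primitive roots of unity of order \<open>p ^ (j + 1)\<close>: for a prime power it is enough to exclude the
  single maximal proper divisor of the order.\<close>

definition primitive_prime_power_root :: "nat \<Rightarrow> nat \<Rightarrow> complex \<Rightarrow> bool" where
  "primitive_prime_power_root p j x \<longleftrightarrow> x ^ (p ^ Suc j) = 1 \<and> x ^ (p ^ j) \<noteq> 1"

lemma power_eq_1_coprime:
  fixes x :: "'a :: comm_monoid_mult"
  assumes "x ^ a = 1" "x ^ b = 1" "Rings.coprime (a :: nat) b"
  shows "x = 1"
proof (cases "a = 0")
  case True
  with assms show ?thesis by simp
next
  case False
  then obtain u v where "a * u = b * v + gcd a b" using bezout_nat by blast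
  then have uv: "a * u = b * v + 1" using assms(3) by simp
  have "x ^ (a * u) = 1" "x ^ (b * v) = 1" using assms by (simp_all add: power_mult)
  then show ?thesis unfolding uv by (simp add: power_add)
qed

lemma qeval_cyclotomic_root:
  assumes "primitive_prime_power_root p j x"
  shows "qeval (map_poly rat_of_int (cyclotomic_prime_power p j)) x = 0"
proof -
  have "map_poly rat_of_int (cyclotomic_prime_power p j) = (\<Sum>i<p. (Polynomial.monom 1 (p ^ j)) ^ i)"
    unfolding cyclotomic_prime_power_def
    by (simp add: of_int_poly_hom.hom_sum of_int_poly_hom.hom_power map_poly_monom)
  then have "qeval (map_poly rat_of_int (cyclotomic_prime_power p j)) x = (\<Sum>i<p. (x ^ (p ^ j)) ^ i)"
    by simp
  moreover have "(x ^ (p ^ j) - 1) * (\<Sum>i<p. (x ^ (p ^ j)) ^ i) = (x ^ (p ^ j)) ^ p - 1"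
    by (simp add: power_diff_1_eq)
  moreover have "(x ^ (p ^ j)) ^ p = 1"
    using assms by (simp add: primitive_prime_power_root_def power_mult[symmetric] mult.commute)
  ultimately show ?thesis using assms by (simp add: primitive_prime_power_root_def)
qed

lemma cyclotomic_dvd_or_bezout:
  assumes p: "Factorial_Ring.prime p"
    and \<Phi>_def: "\<Phi> = map_poly rat_of_int (cyclotomic_prime_power p j)"
  shows "\<Phi> dvd f \<or> (\<exists>a b. a * f + b * \<Phi> = 1)"
proof -
  let ?d = "gcd f \<Phi>"
  obtain e where e: "\<Phi> = ?d * e" by (meson dvdE gcd_dvd2)
  have "Polynomial.degree ?d = 0 \<or> Polynomial.degree e = 0"
    by (rule irreducible_cyclotomic_prime_power[OF p trans[OF \<Phi>_def[symmetric] e]])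
  moreover have ab: "fst (bezout_coefficients f \<Phi>) * f + snd (bezout_coefficients f \<Phi>) * \<Phi> = ?d"
    by (rule bezout_coefficients_fst_snd)
  moreover have nz: "\<Phi> \<noteq> 0"
  proof
    assume "\<Phi> = 0"
    then have "cyclotomic_prime_power p j = 0" by (simp add: \<Phi>_def)
    then show False using shifted_cyclotomic(3)[OF p, of j] by simp
  qed
  ultimately show ?thesis
  proof (elim disjE)
    assume d: "Polynomial.degree ?d = 0"
    then obtain c where c: "?d = [:c:]" by (rule degree_eq_zeroE)
    have "c \<noteq> 0" using c nz by (metis gcd_eq_0_iff pCons_0_0)
    then have "[:inverse c:] * ?d = 1" by (simp add: c)
    then have "[:inverse c:] * fst (bezout_coefficients f \<Phi>) * f + [:inverse c:] * snd (bezout_coefficients f \<Phi>) * \<Phi> = 1"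
      using ab by (metis distrib_left mult.assoc)
    then show ?thesis by blast
  next
    assume d: "Polynomial.degree e = 0"
    then obtain c where c: "e = [:c:]" by (rule degree_eq_zeroE)
    have "c \<noteq> 0" using c nz e by auto
    then have "[:inverse c:] * e = 1" by (simp add: c)
    then have "?d = \<Phi> * [:inverse c:]" using e by (metis mult.assoc mult.commute mult_1)
    then have "\<Phi> dvd ?d" by (rule dvdI)
    then show ?thesis by (meson dvd_trans gcd_dvd1)
  qed
qed

text \<open>A rational polynomial vanishing at \<open>x\<close> cannot be coprime to the cyclotomic polynomial, hence is a
  multiple of it and vanishes at every other primitive root.  This makes the map \<open>f(x) \<mapsto> f(y)\<close> well
  defined.\<close>

lemma qeval_eq_0_conjugate:
  assumes p: "Factorial_Ring.prime p"
    and x: "primitive_prime_power_root p j x" and y: "primitive_prime_power_root p j y"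
    and f: "qeval f x = 0"
  shows "qeval f y = 0"
proof -
  let ?\<Phi> = "map_poly rat_of_int (cyclotomic_prime_power p j)"
  have "\<nexists>a b. a * f + b * ?\<Phi> = 1"
  proof
    assume "\<exists>a b. a * f + b * ?\<Phi> = 1"
    then obtain a b where "a * f + b * ?\<Phi> = 1" by blast
    then have "qeval (a * f + b * ?\<Phi>) x = 1" by simp
    then show False using f qeval_cyclotomic_root[OF x] by simp
  qed
  then have "?\<Phi> dvd f" using cyclotomic_dvd_or_bezout[OF p refl] by blast
  then obtain h where "f = ?\<Phi> * h" by (rule dvdE)
  then show ?thesis using qeval_cyclotomic_root[OF y] by simp
qed

lemma qeval_eq_conjugate:
  assumes p: "Factorial_Ring.prime p"
    and x: "primitive_prime_power_root p j x" and y: "primitive_prime_power_root p j y"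
    and fg: "qeval f x = qeval g x"
  shows "qeval f y = qeval g y"
proof -
  have "qeval (f - g) x = 0" using fg by simp
  then have "qeval (f - g) y = 0" by (rule qeval_eq_0_conjugate[OF p x y])
  then show ?thesis by simp
qed

text \<open>The polynomial expressions in a primitive root already form a field, so a character field, which is
  generated with inverses, stays inside them.\<close>

lemma qeval_inverse:
  assumes p: "Factorial_Ring.prime p" and x: "primitive_prime_power_root p j x"
    and f: "qeval f x \<noteq> 0"
  shows "\<exists>g. qeval g x = inverse (qeval f x)"
proof -
  let ?\<Phi> = "map_poly rat_of_int (cyclotomic_prime_power p j)"
  have "\<not> ?\<Phi> dvd f" using f qeval_cyclotomic_root[OF x] by auto
  then obtain a b where "a * f + b * ?\<Phi> = 1" using cyclotomic_dvd_or_bezout[OF p refl] by blast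
  then have "qeval (a * f + b * ?\<Phi>) x = 1" by simp
  then have "qeval a x * qeval f x = 1" using qeval_cyclotomic_root[OF x] by simp
  then show ?thesis by (metis inverse_unique mult.commute)
qed

section \<open>The Galois group of a character field\<close>

lemma class_ring_a_inv: "a_inv class_ring x = - (x :: 'a :: field)"
proof -
  have "abelian_group (class_ring :: 'a ring)"
    using class_field[where 'a = 'a] by (simp add: field_def domain_def cring_def ring_def)
  then have "a_inv class_ring x \<oplus>\<^bsub>class_ring\<^esub> x = \<zero>\<^bsub>class_ring\<^esub>"
    by (rule abelian_group.l_neg) simp
  then show ?thesis by (simp add: eq_neg_iff_add_eq_0)
qed

lemma class_ring_m_inv: "x \<noteq> 0 \<Longrightarrow> m_inv class_ring x = inverse (x :: 'a :: field)"
proof -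
  have m: "Group.monoid (class_ring :: 'a ring)"
    using class_field[where 'a = 'a] by (simp add: field_def domain_def cring_def ring_def)
  assume "x \<noteq> 0"
  then have "m_inv class_ring x \<otimes>\<^bsub>class_ring\<^esub> x = \<one>\<^bsub>class_ring\<^esub>"
    using field.field_Units[OF class_field] by (intro monoid.Units_l_inv[OF m]) auto
  then show ?thesis by (metis inverse_unique monoid.select_convs(1) mult.commute monoid.select_convs(2))
qed

lemma generate_field_class_ring_induct [consumes 1, case_names one base uminus inverse add mult]:
  fixes H :: "'a :: field set"
  assumes "h \<in> generate_field class_ring H"
    and "P 1" and "\<And>h. h \<in> H \<Longrightarrow> P h"
    and "\<And>h. h \<in> generate_field class_ring H \<Longrightarrow> P h \<Longrightarrow> P (- h)"
    and "\<And>h. h \<in> generate_field class_ring H \<Longrightarrow> P h \<Longrightarrow> h \<noteq> 0 \<Longrightarrow> P (inverse h)"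
    and "\<And>h k. h \<in> generate_field class_ring H \<Longrightarrow> P h \<Longrightarrow> k \<in> generate_field class_ring H \<Longrightarrow> P k \<Longrightarrow> P (h + k)"
    and "\<And>h k. h \<in> generate_field class_ring H \<Longrightarrow> P h \<Longrightarrow> k \<in> generate_field class_ring H \<Longrightarrow> P k \<Longrightarrow> P (h * k)"
  shows "P h"
  using assms(1)
proof (induction rule: generate_field.induct)
  case (a_inv h) then show ?case using assms(4) by (simp add: class_ring_a_inv)
next
  case (m_inv h) then show ?case using assms(5) by (simp add: class_ring_m_inv)
qed (use assms in auto)

lemma generate_field_class_ring_intros:
  fixes H :: "'a :: field set"
  shows "1 \<in> generate_field class_ring H"
    and "h \<in> H \<Longrightarrow> h \<in> generate_field class_ring H"
    and "h \<in> generate_field class_ring H \<Longrightarrow> - h \<in> generate_field class_ring H"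
    and "h \<in> generate_field class_ring H \<Longrightarrow> h \<noteq> 0 \<Longrightarrow> inverse h \<in> generate_field class_ring H"
    and "h \<in> generate_field class_ring H \<Longrightarrow> k \<in> generate_field class_ring H \<Longrightarrow> h + k \<in> generate_field class_ring H"
    and "h \<in> generate_field class_ring H \<Longrightarrow> k \<in> generate_field class_ring H \<Longrightarrow> h * k \<in> generate_field class_ring H"
  using generate_field.one[of class_ring H] generate_field.incl[of h H class_ring]
    generate_field.a_inv[of h class_ring H] generate_field.m_inv[of h class_ring H]
    generate_field.eng_add[of h class_ring H k] generate_field.eng_mult[of h class_ring H k]
  by (simp_all add: class_ring_a_inv class_ring_m_inv)

text \<open>Membership in the Galois group in terms of complex arithmetic only.\<close>

lemma char_galois_iff:
  "\<sigma> \<in> char_galois G \<chi> \<longleftrightarrow>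
     \<sigma> \<in> extensional (char_field G \<chi>) \<and> bij_betw \<sigma> (char_field G \<chi>) (char_field G \<chi>) \<and>
     (\<forall>a \<in> char_field G \<chi>. \<forall>b \<in> char_field G \<chi>. \<sigma> (a + b) = \<sigma> a + \<sigma> b \<and> \<sigma> (a * b) = \<sigma> a * \<sigma> b) \<and>
     (\<forall>q \<in> \<rat>. \<sigma> q = q)"
  unfolding char_galois_def Let_def ring_iso_def Ring.ring_hom_def
  by (auto simp: bij_betw_def Pi_iff)

lemma Rats_subset_char_field: "\<rat> \<subseteq> char_field G \<chi>"
  unfolding char_field_def by (auto intro: generate_field_class_ring_intros)

lemma value_in_char_field: "g \<in> carrier G \<Longrightarrow> \<chi> g \<in> char_field G \<chi>"
  unfolding char_field_def by (auto intro: generate_field_class_ring_intros)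

lemma char_field_sum: "(\<And>i. i \<in> A \<Longrightarrow> f i \<in> char_field G \<chi>) \<Longrightarrow> sum f A \<in> char_field G \<chi>"
  using Rats_subset_char_field[of G \<chi>]
  by (induction A rule: infinite_finite_induct) (auto simp: char_field_def intro: generate_field_class_ring_intros)

lemma char_galois_sum:
  assumes \<sigma>: "\<sigma> \<in> char_galois G \<chi>" and f: "\<And>i. i \<in> A \<Longrightarrow> f i \<in> char_field G \<chi>"
  shows "\<sigma> (sum f A) = (\<Sum>i\<in>A. \<sigma> (f i))"
  using f
proof (induction A rule: infinite_finite_induct)
  case (insert a A)
  then have "sum f A \<in> char_field G \<chi>" by (intro char_field_sum) auto
  with insert \<sigma> show ?case by (simp add: char_galois_iff)
qed (use \<sigma> in \<open>auto simp: char_galois_iff\<close>)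

lemma char_galois_compose:
  assumes "\<sigma> \<in> char_galois G \<chi>" "\<tau> \<in> char_galois G \<chi>"
  shows "compose (char_field G \<chi>) \<sigma> \<tau> \<in> char_galois G \<chi>"
proof -
  let ?K = "char_field G \<chi>"
  have \<tau>K: "\<tau> a \<in> ?K" if "a \<in> ?K" for a
    using assms(2) that by (auto simp: char_galois_iff bij_betw_def)
  have "1 \<in> ?K" "\<And>a b. a \<in> ?K \<Longrightarrow> b \<in> ?K \<Longrightarrow> a + b \<in> ?K \<and> a * b \<in> ?K"
    by (auto simp: char_field_def intro: generate_field_class_ring_intros)
  then show ?thesis
    using assms \<tau>K bij_betw_compose[of \<tau> ?K ?K \<sigma> ?K] Rats_subset_char_field[of G \<chi>]
    unfolding char_galois_iff by (auto simp: compose_def)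
qed

lemma char_galois_inv:
  assumes "\<tau> \<in> char_galois G \<chi>"
  defines "\<tau>' \<equiv> restrict (inv_into (char_field G \<chi>) \<tau>) (char_field G \<chi>)"
  shows "\<tau>' \<in> char_galois G \<chi>"
    and "a \<in> char_field G \<chi> \<Longrightarrow> \<tau>' (\<tau> a) = a" and "a \<in> char_field G \<chi> \<Longrightarrow> \<tau> (\<tau>' a) = a"
proof -
  let ?K = "char_field G \<chi>"
  have b: "bij_betw \<tau> ?K ?K" using assms(1) by (simp add: char_galois_iff)
  then have \<tau>K: "\<tau> a \<in> ?K" if "a \<in> ?K" for a using that by (auto simp: bij_betw_def)
  have b': "bij_betw \<tau>' ?K ?K"
    using bij_betw_inv_into[OF b] unfolding \<tau>'_def by (simp cong: bij_betw_cong)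
  then have \<tau>'K: "\<tau>' a \<in> ?K" if "a \<in> ?K" for a using that by (auto simp: bij_betw_def)
  show l: "\<tau>' (\<tau> a) = a" if "a \<in> ?K" for a
    using b that \<tau>K by (auto simp: \<tau>'_def bij_betw_def)
  show r: "\<tau> (\<tau>' a) = a" if "a \<in> ?K" for a
    using b that by (auto simp: \<tau>'_def bij_betw_def f_inv_into_f)
  have ops: "a + b \<in> ?K \<and> a * b \<in> ?K" if "a \<in> ?K" "b \<in> ?K" for a b
    using that by (auto simp: char_field_def intro: generate_field_class_ring_intros)
  have "\<tau>' (a + b) = \<tau>' a + \<tau>' b \<and> \<tau>' (a * b) = \<tau>' a * \<tau>' b" if ab: "a \<in> ?K" "b \<in> ?K" for a b
  proof -
    have "\<tau> (\<tau>' a + \<tau>' b) = a + b" "\<tau> (\<tau>' a * \<tau>' b) = a * b"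
      using assms(1) \<tau>'K ab r by (simp_all add: char_galois_iff)
    then show ?thesis using l ops \<tau>'K ab by metis
  qed
  moreover have "\<tau>' q = q" if "q \<in> \<rat>" for q
    using l[of q] assms(1) that Rats_subset_char_field[of G \<chi>] by (auto simp: char_galois_iff)
  ultimately show "\<tau>' \<in> char_galois G \<chi>"
    using b' by (auto simp: char_galois_iff \<tau>'_def)
qed

text \<open>This is what lets a sum over the Galois group be reindexed by one of its elements.\<close>

lemma char_galois_right_translation:
  assumes "\<tau> \<in> char_galois G \<chi>"
  shows "bij_betw (\<lambda>\<sigma>. compose (char_field G \<chi>) \<sigma> \<tau>) (char_galois G \<chi>) (char_galois G \<chi>)"
proof -
  let ?K = "char_field G \<chi>" and ?\<tau>' = "restrict (inv_into (char_field G \<chi>) \<tau>) (char_field G \<chi>)"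
  note inv = char_galois_inv[OF assms]
  have K: "\<tau> a \<in> ?K" "?\<tau>' a \<in> ?K" if "a \<in> ?K" for a
    using assms inv(1) that unfolding char_galois_iff bij_betw_def by blast+
  have undef: "\<sigma> a = undefined" if "\<sigma> \<in> char_galois G \<chi>" "a \<notin> ?K" for \<sigma> a
    using that by (auto simp: char_galois_iff extensional_def)
  show ?thesis
  proof (rule bij_betw_byWitness[where f' = "\<lambda>\<sigma>. compose ?K \<sigma> ?\<tau>'"])
    show "\<forall>\<sigma>\<in>char_galois G \<chi>. compose ?K (compose ?K \<sigma> \<tau>) ?\<tau>' = \<sigma>"
    proof (intro ballI ext)
      fix \<sigma> a assume "\<sigma> \<in> char_galois G \<chi>"
      then show "compose ?K (compose ?K \<sigma> \<tau>) ?\<tau>' a = \<sigma> a"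
        using K(2)[of a] inv(3)[of a] undef[of \<sigma> a] unfolding compose_def by (cases "a \<in> ?K") simp_all
    qed
    show "\<forall>\<sigma>\<in>char_galois G \<chi>. compose ?K (compose ?K \<sigma> ?\<tau>') \<tau> = \<sigma>"
    proof (intro ballI ext)
      fix \<sigma> a assume "\<sigma> \<in> char_galois G \<chi>"
      then show "compose ?K (compose ?K \<sigma> ?\<tau>') \<tau> a = \<sigma> a"
        using K(1)[of a] inv(2)[of a] undef[of \<sigma> a] unfolding compose_def by (cases "a \<in> ?K") simp_all
    qed
  qed (use char_galois_compose[OF _ assms] char_galois_compose[OF _ inv(1)] in auto)
qed

text \<open>The automorphism \<open>f(x) \<mapsto> f(y)\<close> of the cyclotomic field maps \<open>\<chi>(g)\<close> to \<open>\<chi>(\<pi> g)\<close>.  It therefore permutes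
  the generators of the character field and restricts to an automorphism of that field.\<close>

lemma cyclotomic_automorphism_restricts:
  assumes p: "Factorial_Ring.prime p"
    and x: "primitive_prime_power_root p j x" and y: "primitive_prime_power_root p j y"
    and \<pi>: "\<pi> ` carrier G = carrier G"
    and f: "\<And>g. g \<in> carrier G \<Longrightarrow> \<exists>f. qeval f x = \<chi> g \<and> qeval f y = \<chi> (\<pi> g)"
  shows "\<exists>\<tau> \<in> char_galois G \<chi>. \<forall>g \<in> carrier G. \<tau> (\<chi> g) = \<chi> (\<pi> g)"
proof -
  let ?K = "char_field G \<chi>"
  have Kind: "P c" if "c \<in> ?K" "\<And>q. q \<in> \<rat> \<Longrightarrow> P q" "\<And>g. g \<in> carrier G \<Longrightarrow> P (\<chi> g)"
      "\<And>a. P a \<Longrightarrow> P (- a)" "\<And>a. P a \<Longrightarrow> a \<noteq> 0 \<Longrightarrow> P (inverse a)"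
      "\<And>a b. P a \<Longrightarrow> P b \<Longrightarrow> P (a + b)" "\<And>a b. P a \<Longrightarrow> P b \<Longrightarrow> P (a * b)" for c P
    using that(1) unfolding char_field_def
    by (induction rule: generate_field_class_ring_induct) (use that in auto)
  have KR: "\<rat> \<subseteq> ?K" by (rule Rats_subset_char_field)
  have K: "a + b \<in> ?K" "a * b \<in> ?K" "- a \<in> ?K" "inverse a \<in> ?K" if "a \<in> ?K" "b \<in> ?K" for a b
    using that generate_field_class_ring_intros(3-6)[of _ "\<rat> \<union> \<chi> ` carrier G"]
    by (cases "a = 0"; simp add: char_field_def)+
  define \<tau> where "\<tau> = (\<lambda>c\<in>?K. qeval (SOME f. qeval f x = c) y)"
  have \<tau>: "\<tau> (qeval f x) = qeval f y" if "qeval f x \<in> ?K" for f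
  proof -
    have "qeval (SOME f'. qeval f' x = qeval f x) x = qeval f x" by (rule someI) simp
    then have "qeval (SOME f'. qeval f' x = qeval f x) y = qeval f y"
      by (rule qeval_eq_conjugate[OF p x y])
    then show ?thesis using that by (simp add: \<tau>_def)
  qed
  have inv_conj: "qeval h y = inverse (qeval f y)" if "qeval h x = inverse (qeval f x)" "qeval f x \<noteq> 0" for f h
  proof -
    have "qeval (h * f) x = qeval 1 x" using that by simp
    then have "qeval (h * f) y = qeval 1 y" by (rule qeval_eq_conjugate[OF p x y])
    then show ?thesis by (metis inverse_unique mult.commute qeval_simps(2,6))
  qed
  have inK: "\<exists>f. qeval f x = c \<and> qeval f y \<in> ?K" if "c \<in> ?K" for c
    using that
  proof (rule Kind)
    fix q :: complex assume "q \<in> \<rat>"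
    then obtain r where "q = of_rat r" by (auto elim: Rats_cases)
    then show "\<exists>f. qeval f x = q \<and> qeval f y \<in> ?K" using KR by (intro exI[of _ "[:r:]"]) auto
  next
    fix g assume g: "g \<in> carrier G"
    then have "\<pi> g \<in> carrier G" using \<pi> by blast
    then show "\<exists>f. qeval f x = \<chi> g \<and> qeval f y \<in> ?K" using f[OF g] value_in_char_field by metis
  next
    fix a assume "\<exists>f. qeval f x = a \<and> qeval f y \<in> ?K"
    then show "\<exists>f. qeval f x = - a \<and> qeval f y \<in> ?K" using K(3) by (metis qeval_simps(3))
  next
    fix a assume "\<exists>f. qeval f x = a \<and> qeval f y \<in> ?K" "a \<noteq> 0"
    then obtain f where f: "qeval f x = a" "qeval f y \<in> ?K" by blast
    obtain h where h: "qeval h x = inverse (qeval f x)" using qeval_inverse[OF p x] f \<open>a \<noteq> 0\<close> by blast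
    have "qeval h y = inverse (qeval f y)" by (rule inv_conj) (use h f \<open>a \<noteq> 0\<close> in auto)
    then show "\<exists>f. qeval f x = inverse a \<and> qeval f y \<in> ?K" using h f K(4) by metis
  next
    fix a b assume "\<exists>f. qeval f x = a \<and> qeval f y \<in> ?K" "\<exists>f. qeval f x = b \<and> qeval f y \<in> ?K"
    then obtain f h where "qeval f x = a" "qeval f y \<in> ?K" "qeval h x = b" "qeval h y \<in> ?K" by blast
    then show "\<exists>f. qeval f x = a + b \<and> qeval f y \<in> ?K" "\<exists>f. qeval f x = a * b \<and> qeval f y \<in> ?K"
      using K(1,2) qeval_simps(1,2) by metis+
  qed
  have onto: "\<exists>f. qeval f x \<in> ?K \<and> qeval f y = c" if "c \<in> ?K" for c
    using that
  proof (rule Kind)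
    fix q :: complex assume "q \<in> \<rat>"
    then obtain r where "q = of_rat r" by (auto elim: Rats_cases)
    then show "\<exists>f. qeval f x \<in> ?K \<and> qeval f y = q" using KR by (intro exI[of _ "[:r:]"]) auto
  next
    fix g assume "g \<in> carrier G"
    then obtain h where h: "h \<in> carrier G" "g = \<pi> h" using \<pi> by blast
    then show "\<exists>f. qeval f x \<in> ?K \<and> qeval f y = \<chi> g" using f[OF h(1)] value_in_char_field by metis
  next
    fix a assume "\<exists>f. qeval f x \<in> ?K \<and> qeval f y = a"
    then show "\<exists>f. qeval f x \<in> ?K \<and> qeval f y = - a" using K(3) by (metis qeval_simps(3))
  next
    fix a assume "\<exists>f. qeval f x \<in> ?K \<and> qeval f y = a" "a \<noteq> 0"
    then obtain f where f: "qeval f y = a" "qeval f x \<in> ?K" by blast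
    have nz: "qeval f x \<noteq> 0" using qeval_eq_0_conjugate[OF p x y] f \<open>a \<noteq> 0\<close> by blast
    obtain h where h: "qeval h x = inverse (qeval f x)" using qeval_inverse[OF p x nz] by blast
    have "qeval h y = inverse (qeval f y)" by (rule inv_conj[OF h nz])
    then show "\<exists>f. qeval f x \<in> ?K \<and> qeval f y = inverse a" using h f K(4) by metis
  next
    fix a b assume "\<exists>f. qeval f x \<in> ?K \<and> qeval f y = a" "\<exists>f. qeval f x \<in> ?K \<and> qeval f y = b"
    then obtain f h where "qeval f y = a" "qeval f x \<in> ?K" "qeval h y = b" "qeval h x \<in> ?K" by blast
    then show "\<exists>f. qeval f x \<in> ?K \<and> qeval f y = a + b" "\<exists>f. qeval f x \<in> ?K \<and> qeval f y = a * b"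
      using K(1,2) qeval_simps(1,2) by metis+
  qed
  have "inj_on \<tau> ?K"
  proof (rule inj_onI)
    fix a b assume ab: "a \<in> ?K" "b \<in> ?K" "\<tau> a = \<tau> b"
    obtain f h where fh: "qeval f x = a" "qeval h x = b" using inK ab by metis
    then have "qeval f y = qeval h y" using \<tau>[of f] \<tau>[of h] ab by simp
    then have "qeval f x = qeval h x" by (rule qeval_eq_conjugate[OF p y x])
    then show "a = b" using fh by simp
  qed
  moreover have "\<tau> ` ?K = ?K"
  proof
    show "\<tau> ` ?K \<subseteq> ?K" using inK \<tau> by (metis image_subsetI)
    show "?K \<subseteq> \<tau> ` ?K" using onto \<tau> by (metis image_eqI subsetI)
  qed
  moreover have "\<tau> (a + b) = \<tau> a + \<tau> b \<and> \<tau> (a * b) = \<tau> a * \<tau> b" if ab: "a \<in> ?K" "b \<in> ?K" for a b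
  proof -
    obtain f h where fh: "qeval f x = a" "qeval h x = b" using inK ab by metis
    show ?thesis using \<tau>[of f] \<tau>[of h] \<tau>[of "f + h"] \<tau>[of "f * h"] fh K(1,2)[OF ab] ab by simp
  qed
  moreover have "\<tau> q = q" if q: "q \<in> \<rat>" for q
  proof -
    obtain r where "q = of_rat r" using q by (auto elim: Rats_cases)
    moreover from this have "of_rat r \<in> ?K" using q KR by auto
    ultimately show ?thesis using \<tau>[of "[:r:]"] by simp
  qed
  moreover have "\<tau> (\<chi> g) = \<chi> (\<pi> g)" if g: "g \<in> carrier G" for g
    using f[OF g] \<tau> value_in_char_field[OF g, of \<chi>] by metis
  ultimately show ?thesis
    by (intro bexI[of _ \<tau>]) (auto simp: char_galois_iff bij_betw_def \<tau>_def)
qed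

text \<open>The Galois group is partitioned according to the exponent \<open>u\<close> in \<open>\<sigma>(\<omega>) = \<omega> ^ u\<close>, with
  \<open>u = 1, \<dots>, p - 1\<close>.  Translation by an automorphism that raises \<open>\<omega>\<close> to the power \<open>u\<close> carries the
  part for \<open>1\<close> onto the part for \<open>u\<close>, so all parts have the same size.\<close>

lemma prime_minus_one_dvd_card_char_galois:
  assumes p: "Factorial_Ring.prime p" and \<omega>: "\<omega> ^ p = 1" "\<omega> \<noteq> 1" "\<omega> \<in> char_field G \<chi>"
    and \<tau>: "\<And>u. \<not> p dvd u \<Longrightarrow> \<exists>\<tau> \<in> char_galois G \<chi>. \<tau> \<omega> = \<omega> ^ u"
  shows "p - 1 dvd card (char_galois G \<chi>)"
proof (cases "finite (char_galois G \<chi>)")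
  case fin: True
  let ?\<Gamma> = "char_galois G \<chi>" and ?K = "char_field G \<chi>"
  let ?F = "\<lambda>u. {\<sigma> \<in> ?\<Gamma>. \<sigma> \<omega> = \<omega> ^ u}"
  have Kp: "\<omega> ^ i \<in> ?K" for i
    using \<omega>(3) by (induction i) (auto simp: char_field_def intro: generate_field_class_ring_intros)
  have pow: "\<sigma> (\<omega> ^ i) = \<sigma> \<omega> ^ i" if "\<sigma> \<in> ?\<Gamma>" for \<sigma> i
    using that Kp \<omega>(3) by (induction i) (auto simp: char_galois_iff)
  have p1: "p > 1" using p by (rule prime_gt_1_nat)
  have inj: "inj_on (\<lambda>i. \<omega> ^ i) {..<p}"
  proof (rule linorder_inj_onI)
    fix a b :: nat assume ab: "a < b" "a \<in> {..<p}" "b \<in> {..<p}"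
    show "\<omega> ^ a \<noteq> \<omega> ^ b"
    proof
      assume eq: "\<omega> ^ a = \<omega> ^ b"
      have "\<omega> ^ a * \<omega> ^ (b - a) = \<omega> ^ b"
        using ab by (subst power_add[symmetric]) simp
      then have "\<omega> ^ a * \<omega> ^ (b - a) = \<omega> ^ a * 1" using eq by simp
      moreover have "\<omega> \<noteq> 0" using \<omega>(1) p1 by (auto simp: power_0_left)
      ultimately have "\<omega> ^ (b - a) = 1" by simp
      moreover have "\<not> p dvd b - a" using ab by (auto dest: dvd_imp_le)
      then have "Rings.coprime (b - a) p"
        using prime_imp_power_coprime_nat[OF p, of _ 1] by simp
      ultimately show False using power_eq_1_coprime[of \<omega> "b - a" p] \<omega> by blast
    qed
  qed auto
  have roots: "z \<in> (\<lambda>i. \<omega> ^ i) ` {..<p}" if "z ^ p = 1" for z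
  proof -
    have "(\<lambda>i. \<omega> ^ i) ` {..<p} = {z. z ^ p = 1}"
    proof (rule card_seteq)
      show "finite {z :: complex. z ^ p = 1}" using p1 by (intro finite_roots_unity) auto
      show "(\<lambda>i. \<omega> ^ i) ` {..<p} \<subseteq> {z. z ^ p = 1}"
        using \<omega>(1) by auto (metis mult.commute power_mult power_one)
      show "card {z :: complex. z ^ p = 1} \<le> card ((\<lambda>i. \<omega> ^ i) ` {..<p})"
        using card_roots_unity[of p] p1 inj by (simp add: card_image)
    qed
    then show ?thesis using that by blast
  qed
  have un: "?\<Gamma> = (\<Union>u\<in>{1..<p}. ?F u)"
  proof
    show "?\<Gamma> \<subseteq> (\<Union>u\<in>{1..<p}. ?F u)"
    proof
      fix \<sigma> assume \<sigma>: "\<sigma> \<in> ?\<Gamma>"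
      have "\<sigma> \<omega> ^ p = 1" using pow[OF \<sigma>, of p] \<omega>(1) \<sigma> by (simp add: char_galois_iff)
      then obtain u where u: "u < p" "\<sigma> \<omega> = \<omega> ^ u" using roots by blast
      have "\<sigma> \<omega> \<noteq> \<sigma> 1"
        using \<sigma> \<omega> Rats_subset_char_field[of G \<chi>] unfolding char_galois_iff bij_betw_def
        by (metis Rats_1 inj_onD subsetD)
      then have "u \<noteq> 0" using u \<sigma> by (auto simp: char_galois_iff intro!: Nat.gr0I)
      then show "\<sigma> \<in> (\<Union>u\<in>{1..<p}. ?F u)" using u \<sigma> by auto
    qed
  qed auto
  have cu: "card (\<Union>u\<in>{1..<p}. ?F u) = (\<Sum>u\<in>{1..<p}. card (?F u))"
  proof (rule card_UN_disjoint)
    show "\<forall>i\<in>{1..<p}. \<forall>j\<in>{1..<p}. i \<noteq> j \<longrightarrow> ?F i \<inter> ?F j = {}"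
      using inj by (auto simp: inj_on_def)
  qed (use fin in auto)
  have ceq: "card (?F u) = card (?F 1)" if u: "u \<in> {1..<p}" for u
  proof -
    have "\<not> p dvd u" using u by (auto dest: dvd_imp_le)
    then obtain \<tau> where t: "\<tau> \<in> ?\<Gamma>" "\<tau> \<omega> = \<omega> ^ u" using \<tau> by blast
    let ?c = "\<lambda>\<sigma>. compose ?K \<sigma> \<tau>"
    note b = char_galois_right_translation[OF t(1)]
    have val: "?c \<sigma> \<omega> = \<sigma> \<omega> ^ u" if "\<sigma> \<in> ?\<Gamma>" for \<sigma>
      using that \<omega>(3) t pow by (simp add: compose_def)
    have "?c ` ?F 1 = ?F u"
    proof
      show "?c ` ?F 1 \<subseteq> ?F u" using val b by (auto simp: bij_betw_def)
      show "?F u \<subseteq> ?c ` ?F 1"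
      proof
        fix \<rho> assume \<rho>: "\<rho> \<in> ?F u"
        then obtain \<sigma> where \<sigma>: "\<sigma> \<in> ?\<Gamma>" "\<rho> = ?c \<sigma>" using b unfolding bij_betw_def by blast
        have su: "\<sigma> \<omega> ^ u = \<omega> ^ u" using \<rho> val[OF \<sigma>(1)] \<sigma>(2) by simp
        have sp: "\<sigma> \<omega> ^ p = 1" using pow[OF \<sigma>(1), of p] \<omega>(1) \<sigma>(1) by (simp add: char_galois_iff)
        have nz: "\<omega> \<noteq> 0" using \<omega>(1) p1 by (auto simp: power_0_left)
        have "(\<sigma> \<omega> / \<omega>) = 1"
        proof (rule power_eq_1_coprime)
          show "(\<sigma> \<omega> / \<omega>) ^ u = 1" using su nz by (simp add: power_divide)
          show "(\<sigma> \<omega> / \<omega>) ^ p = 1" using sp \<omega>(1) by (simp add: power_divide)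
          show "Rings.coprime u p" using prime_imp_power_coprime_nat[OF p \<open>\<not> p dvd u\<close>, of 1] by simp
        qed
        then have "\<sigma> \<in> ?F 1" using nz \<sigma>(1) by simp
        then show "\<rho> \<in> ?c ` ?F 1" using \<sigma>(2) by blast
      qed
    qed
    moreover have "inj_on ?c (?F 1)" using b by (auto simp: bij_betw_def inj_on_def)
    ultimately show ?thesis using card_image[of ?c "?F 1"] by simp
  qed
  have "card ?\<Gamma> = (\<Sum>u\<in>{1..<p}. card (?F u))" using arg_cong[OF un, of card] cu by (rule trans)
  also have "\<dots> = (\<Sum>u\<in>{1..<p}. card (?F 1))" by (rule sum.cong[OF refl ceq])
  finally show ?thesis by simp
qed simp

section \<open>Matrices of finite order\<close>

lemma mat_trace_commute:
  assumes "A \<in> carrier_mat n n" "B \<in> carrier_mat n n"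
  shows "mat_trace (A * B) = mat_trace (B * A)"
proof -
  have "mat_trace (A * B) = (\<Sum>i<n. \<Sum>k<n. A $$ (i, k) * B $$ (k, i))"
    using assms by (auto simp: mat_trace_def scalar_prod_def atLeast0LessThan intro!: sum.cong)
  also have "\<dots> = (\<Sum>k<n. \<Sum>i<n. B $$ (k, i) * A $$ (i, k))"
    by (subst sum.swap) (simp add: mult.commute)
  also have "\<dots> = mat_trace (B * A)"
    using assms by (auto simp: mat_trace_def scalar_prod_def atLeast0LessThan intro!: sum.cong)
  finally show ?thesis .
qed

lemma diag_block_mat_eq_one:
  fixes As :: "'a :: {zero, one} mat list"
  assumes "diag_block_mat As = 1\<^sub>m N" "\<And>A. A \<in> set As \<Longrightarrow> square_mat A" "A \<in> set As"
  shows "A = 1\<^sub>m (dim_row A)"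
  using assms
proof (induction As arbitrary: N)
  case (Cons B Bs)
  let ?C = "diag_block_mat Bs"
  have sqB: "dim_col B = dim_row B" using Cons.prems(2)[of B] by simp
  have "square_mat ?C" using Cons.prems(2) by (intro diag_block_mat_square) auto
  then have sqC: "dim_col ?C = dim_row ?C" by simp
  have eq: "four_block_mat B (0\<^sub>m (dim_row B) (dim_row ?C)) (0\<^sub>m (dim_row ?C) (dim_row B)) ?C = 1\<^sub>m N"
    using Cons.prems(1) sqB sqC by (simp add: Let_def)
  have "dim_row (1\<^sub>m N :: 'a mat) = dim_row B + dim_row ?C" unfolding eq[symmetric] by simp
  then have N: "N = dim_row B + dim_row ?C" by simp
  have "B = 1\<^sub>m (dim_row B)"
  proof (rule eq_matI)
    fix i j assume "i < dim_row (1\<^sub>m (dim_row B))" "j < dim_col (1\<^sub>m (dim_row B))"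
    then show "B $$ (i, j) = 1\<^sub>m (dim_row B) $$ (i, j)"
      using arg_cong[OF eq, of "\<lambda>M. M $$ (i, j)"] sqB sqC N by simp
  qed (use sqB in auto)
  moreover have "?C = 1\<^sub>m (dim_row ?C)"
  proof (rule eq_matI)
    fix i j assume "i < dim_row (1\<^sub>m (dim_row ?C))" "j < dim_col (1\<^sub>m (dim_row ?C))"
    then show "?C $$ (i, j) = 1\<^sub>m (dim_row ?C) $$ (i, j)"
      using arg_cong[OF eq, of "\<lambda>M. M $$ (dim_row B + i, dim_row B + j)"] sqB sqC N by simp
  qed (use sqC in auto)
  ultimately show ?case using Cons.IH[of "dim_row ?C"] Cons.prems(2,3) by auto
qed simp

text \<open>A block of size at least two with eigenvalue \<open>a\<close> has the entry \<open>m * a ^ (m - 1)\<close> above the diagonal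
  of its \<open>m\<close>-th power, and this is nonzero in characteristic zero.\<close>

lemma jordan_block_power_eq_one:
  fixes a :: complex
  assumes "jordan_block k a ^\<^sub>m m = 1\<^sub>m k" "m > 0" "k > 0"
  shows "k = 1" "a ^ m = 1"
proof -
  have e: "(jordan_block k a ^\<^sub>m m) $$ (i, j) = (if i \<le> j then of_nat (m choose (j - i)) * a ^ (m + i - j) else 0)"
    if "i < k" "j < k" for i j
    unfolding jordan_block_pow using that by simp
  show a: "a ^ m = 1" using e[of 0 0] assms by simp
  show "k = 1"
  proof (rule ccontr)
    assume "k \<noteq> 1"
    then have k: "1 < k" using assms by simp
    have "of_nat m * a ^ (m - 1) = 0" using e[of 0 1] assms k by simp
    then have "a = 0" using assms(2) by auto
    then show False using a assms(2) by (simp add: power_0_left)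
  qed
qed

lemma jordan_matrix_size_one:
  assumes "\<And>k a. (k, a) \<in> set n_as \<Longrightarrow> k = 1"
  shows "jordan_matrix n_as =
    mat (length n_as) (length n_as) (\<lambda>(i, j). if i = j then snd (n_as ! i) else 0)"
  using assms
proof (induction n_as)
  case Nil
  show ?case by (rule eq_matI) (auto simp: jordan_matrix_def)
next
  case (Cons x xs)
  obtain a where x: "x = (1, a)" using Cons.prems[of "fst x" "snd x"] by (cases x) auto
  have "map fst xs = map (\<lambda>_. 1) xs" 
  proof (rule map_cong[OF refl])
    fix q assume "q \<in> set xs"
    then show "fst q = 1" using Cons.prems[of "fst q" "snd q"] by simp
  qed
  then have l: "sum_list (map fst xs) = length xs" by (simp only: sum_list_triv) simp
  have IH: "jordan_matrix xs = mat (length xs) (length xs) (\<lambda>(i, j). if i = j then snd (xs ! i) else 0)"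
    using Cons by auto
  show ?case unfolding x jordan_matrix_Cons l IH
    by (rule eq_matI) (auto simp: nth_Cons' jordan_block_def)
qed

lemma diagonal_mat_power:
  fixes f :: "nat \<Rightarrow> 'a :: comm_ring_1"
  shows "mat d d (\<lambda>(i, j). if i = j then f i else 0) ^\<^sub>m k = mat d d (\<lambda>(i, j). if i = j then f i ^ k else 0)"
proof (induction k)
  case 0
  show ?case by (rule eq_matI) auto
next
  case (Suc k)
  show ?case unfolding pow_mat.simps Suc
  proof (rule eq_matI)
    fix i j assume ij: "i < dim_row (mat d d (\<lambda>(i, j). if i = j then f i ^ Suc k else 0))"
        "j < dim_col (mat d d (\<lambda>(i, j). if i = j then f i ^ Suc k else 0))"
    then have "(mat d d (\<lambda>(i, j). if i = j then f i ^ k else 0) * mat d d (\<lambda>(i, j). if i = j then f i else 0)) $$ (i, j)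
      = (\<Sum>l\<in>{0..<d}. (if i = l then f i ^ k else 0) * (if l = j then f l else 0))"
      by (simp add: scalar_prod_def)
    also have "\<dots> = (\<Sum>l\<in>{0..<d}. if l = i then (if i = j then f i ^ Suc k else 0) else 0)"
      by (rule sum.cong) (auto simp: mult.commute)
    also have "\<dots> = (if i = j then f i ^ Suc k else 0)" using ij by simp
    finally show "(mat d d (\<lambda>(i, j). if i = j then f i ^ k else 0) * mat d d (\<lambda>(i, j). if i = j then f i else 0)) $$ (i, j)
      = mat d d (\<lambda>(i, j). if i = j then f i ^ Suc k else 0) $$ (i, j)" using ij by simp
  qed auto
qed

text \<open>A complex matrix of finite order is diagonalisable.  What characters need from this is one list of
  eigenvalues that computes the traces of all powers and that recognises the identity.\<close>

lemma finite_order_mat_eigenvalues: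
  assumes A: "A \<in> carrier_mat n n" and m: "A ^\<^sub>m m = 1\<^sub>m n" "m > 0"
  obtains es :: "complex list" where
    "length es = n" "\<And>e. e \<in> set es \<Longrightarrow> e ^ m = 1"
    "\<And>k. mat_trace (A ^\<^sub>m k) = (\<Sum>e\<leftarrow>es. e ^ k)"
    "(\<forall>e \<in> set es. e = 1) \<Longrightarrow> A = 1\<^sub>m n"
proof -
  obtain as where "char_poly A = (\<Prod>a\<leftarrow>as. [:- a, 1:])" using char_poly_factorized[OF A] by blast
  then obtain n_as where jnf: "jordan_nf A n_as" using jordan_nf_exists[OF A] by blast
  let ?J = "jordan_matrix n_as" and ?d = "length n_as" and ?f = "\<lambda>i. snd (n_as ! i)"
  obtain P Q where wit: "similar_mat_wit A ?J P Q"
    using jnf unfolding jordan_nf_def similar_mat_def by blast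
  note w = similar_mat_witD2[OF A wit]
  have Apow: "A ^\<^sub>m k = P * ?J ^\<^sub>m k * Q" for k by (rule similar_mat_wit_pow_id[OF wit])
  have Jpow: "?J ^\<^sub>m k \<in> carrier_mat n n" for k using w(5) by (rule pow_carrier_mat)
  have "?J ^\<^sub>m m = (Q * P) * ?J ^\<^sub>m m * (Q * P)"
    using w(2) left_mult_one_mat[OF Jpow[of m]] right_mult_one_mat[OF Jpow[of m]] by simp
  also have "\<dots> = Q * (P * ?J ^\<^sub>m m * Q) * P"
    using w(6,7) Jpow[of m] by (simp add: assoc_mult_mat[of _ n n _ n _ n])
  also have "\<dots> = 1\<^sub>m n" unfolding Apow[symmetric] m(1) using w by simp
  finally have J1: "?J ^\<^sub>m m = 1\<^sub>m n" .
  have blk: "k = 1 \<and> a ^ m = 1" if ka: "(k, a) \<in> set n_as" for k a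
  proof -
    have "jordan_block k a ^\<^sub>m m = 1\<^sub>m (dim_row (jordan_block k a ^\<^sub>m m))"
      by (rule diag_block_mat_eq_one[OF J1[unfolded jordan_matrix_pow]]) (use ka in force)+
    moreover have "k > 0" using jnf ka unfolding jordan_nf_def by (force intro: Nat.gr0I)
    ultimately show ?thesis using jordan_block_power_eq_one[of k a m] m(2) by simp
  qed
  have J: "?J = mat ?d ?d (\<lambda>(i, j). if i = j then ?f i else 0)"
    using blk by (intro jordan_matrix_size_one) blast
  have "dim_row ?J = ?d" by (rule trans[OF arg_cong[OF J, of dim_row]]) simp
  then have d: "?d = n" using carrier_matD(1)[OF w(5)] by (rule trans[OF sym])
  show thesis
  proof (rule that[of "map snd n_as"])
    show "length (map snd n_as) = n" using d by simp
    show "e ^ m = 1" if "e \<in> set (map snd n_as)" for e using that blk by auto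
    show "mat_trace (A ^\<^sub>m k) = (\<Sum>e\<leftarrow>map snd n_as. e ^ k)" for k
    proof -
      have "mat_trace (A ^\<^sub>m k) = mat_trace (Q * (P * ?J ^\<^sub>m k))"
        unfolding Apow using w(6,7) Jpow[of k] by (intro mat_trace_commute[of _ n]) auto
      also have "Q * (P * ?J ^\<^sub>m k) = (Q * P) * ?J ^\<^sub>m k"
        using w(6,7) Jpow[of k] by (simp add: assoc_mult_mat[of _ n n _ n _ n])
      also have "\<dots> = ?J ^\<^sub>m k" using w(2) left_mult_one_mat[OF Jpow[of k]] by simp
      also have "\<dots> = mat ?d ?d (\<lambda>(i, j). if i = j then ?f i ^ k else 0)"
        unfolding J by (rule diagonal_mat_power)
      also have "mat_trace \<dots> = (\<Sum>i<?d. ?f i ^ k)" by (simp add: mat_trace_def)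
      also have "\<dots> = (\<Sum>e\<leftarrow>map snd n_as. e ^ k)"
        by (simp add: sum_list_sum_nth atLeast0LessThan)
      finally show ?thesis .
    qed
    assume one: "\<forall>e \<in> set (map snd n_as). e = 1"
    have "?J = 1\<^sub>m n"
      unfolding J using one by (intro eq_matI) (auto simp: d)
    then show "A = 1\<^sub>m n" using w by simp
  qed
qed

text \<open>Equality in the triangle inequality: each real part is at most \<open>1\<close>, and the real parts add up to
  the number of terms.\<close>

lemma sum_list_of_unit_complex:
  fixes es :: "complex list"
  assumes "\<And>e. e \<in> set es \<Longrightarrow> norm e = 1" and "sum_list es = of_nat (length es)" and "e \<in> set es"
  shows "e = 1"
proof -
  have le: "Re x \<le> 1" if "x \<in> set es" for x using assms(1)[OF that] complex_Re_le_cmod[of x] by simp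
  have "Re (sum_list xs) \<le> length xs \<and> (Re (sum_list xs) = length xs \<longrightarrow> (\<forall>x \<in> set xs. Re x = 1))"
    if "set xs \<subseteq> set es" for xs
    using that
  proof (induction xs)
    case (Cons x xs)
    have x: "Re x \<le> 1" using le Cons.prems by simp
    have IH: "Re (sum_list xs) \<le> length xs" "Re (sum_list xs) = length xs \<Longrightarrow> \<forall>y \<in> set xs. Re y = 1"
      using Cons by simp_all
    have "Re (sum_list (x # xs)) = Re x + Re (sum_list xs)" "real (length (x # xs)) = 1 + real (length xs)"
      by simp_all
    then show ?case using x IH by (smt (verit) set_ConsD)
  qed simp
  from this[of es] have "Re e = 1" using assms by simp
  moreover have "(Re e)\<^sup>2 + (Im e)\<^sup>2 = 1" using assms(1)[OF assms(3)] by (simp add: cmod_def)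
  ultimately show ?thesis by (simp add: complex_eq_iff)
qed

lemma norm_root_of_unity:
  fixes e :: complex assumes "e ^ m = 1" "m > 0" shows "norm e = 1"
proof -
  have "norm e ^ m = 1 ^ m" using arg_cong[OF assms(1), of norm] by (simp add: norm_power)
  then show ?thesis using assms(2) by (intro power_eq_imp_eq_base[of "norm e" m 1]) auto
qed

section \<open>Integer spans and algebraic integers\<close>

definition int_span :: "('s \<Rightarrow> 'a :: comm_ring_1) \<Rightarrow> 's set \<Rightarrow> 'a set" where
  "int_span v S = {\<Sum>t\<in>S. of_int (M t) * v t | M :: 's \<Rightarrow> int. True}"

lemma int_span_generator: "finite S \<Longrightarrow> s \<in> S \<Longrightarrow> v s \<in> int_span v S"
  unfolding int_span_def
  by (auto intro!: exI[of _ "\<lambda>t. if t = s then 1 else 0"] simp: if_distrib[of of_int] if_distrib[of "\<lambda>x. x * _"] cong: if_cong)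

lemma int_span_0: "0 \<in> int_span v S"
  unfolding int_span_def by (auto intro!: exI[of _ "\<lambda>t. 0"])

lemma int_span_add: "x \<in> int_span v S \<Longrightarrow> y \<in> int_span v S \<Longrightarrow> x + y \<in> int_span v S"
  unfolding int_span_def
proof clarify
  fix M N :: "'b \<Rightarrow> int"
  show "\<exists>K :: 'b \<Rightarrow> int. (\<Sum>t\<in>S. of_int (M t) * v t) + (\<Sum>t\<in>S. of_int (N t) * v t) = (\<Sum>t\<in>S. of_int (K t) * v t) \<and> True"
    by (intro exI[of _ "\<lambda>t. M t + N t"]) (simp add: sum.distrib algebra_simps)
qed

lemma int_span_sum: "(\<And>i. i \<in> I \<Longrightarrow> f i \<in> int_span v S) \<Longrightarrow> sum f I \<in> int_span v S"
  by (induction I rule: infinite_finite_induct) (auto intro: int_span_0 int_span_add)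

lemma int_span_sum_list: "(\<And>x. x \<in> set xs \<Longrightarrow> f x \<in> int_span v S) \<Longrightarrow> (\<Sum>x\<leftarrow>xs. f x) \<in> int_span v S"
  by (induction xs) (auto intro: int_span_0 int_span_add)

text \<open>Multiplication by \<open>q\<close> acts on the generators through an integer matrix, of which \<open>q\<close> is an
  eigenvalue with eigenvector \<open>v\<close>.  So \<open>q\<close> is a root of a monic integer polynomial, the
  characteristic polynomial.\<close>

lemma algebraic_int_if_int_span_stable:
  fixes v :: "'s \<Rightarrow> complex"
  assumes S: "finite S" and s0: "s0 \<in> S" "v s0 \<noteq> 0" and q: "\<And>s. s \<in> S \<Longrightarrow> q * v s \<in> int_span v S"
  shows "algebraic_int q"
proof -
  obtain M :: "'s \<Rightarrow> 's \<Rightarrow> int" where M: "\<And>s. s \<in> S \<Longrightarrow> q * v s = (\<Sum>t\<in>S. of_int (M s t) * v t)"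
    using q unfolding int_span_def mem_Collect_eq by metis
  obtain f where f: "bij_betw f {0..<card S} S" using ex_bij_betw_nat_finite[OF S] by blast
  let ?d = "card S"
  define B :: "int mat" where "B = mat ?d ?d (\<lambda>(i, j). M (f i) (f j))"
  define w where "w = vec ?d (\<lambda>i. v (f i))"
  have B: "B \<in> carrier_mat ?d ?d" "map_mat (of_int :: int \<Rightarrow> complex) B \<in> carrier_mat ?d ?d"
    by (auto simp: B_def)
  have fS: "f i \<in> S" if "i < ?d" for i using f that by (auto simp: bij_betw_def)
  have "map_mat of_int B *\<^sub>v w = q \<cdot>\<^sub>v w"
  proof (rule eq_vecI)
    fix i assume "i < dim_vec (q \<cdot>\<^sub>v w)"
    then have i: "i < ?d" by (simp add: w_def)
    have "(map_mat of_int B *\<^sub>v w) $ i = (\<Sum>j\<in>{0..<?d}. of_int (M (f i) (f j)) * v (f j))"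
      using i by (simp add: B_def w_def scalar_prod_def)
    also have "\<dots> = (\<Sum>t\<in>S. of_int (M (f i) t) * v t)"
      by (rule sum.reindex_bij_betw[OF f])
    also have "\<dots> = q * v (f i)" using M fS[OF i] by simp
    finally show "(map_mat of_int B *\<^sub>v w) $ i = (q \<cdot>\<^sub>v w) $ i" using i by (simp add: w_def)
  qed (auto simp: B_def w_def)
  moreover have "w \<noteq> 0\<^sub>v ?d"
  proof
    assume w0: "w = 0\<^sub>v ?d"
    obtain i where i: "i < ?d" "f i = s0" using f s0 unfolding bij_betw_def by force
    have "w $ i = 0" using w0 i by simp
    then show False using i s0 by (simp add: w_def)
  qed
  ultimately have "eigenvalue (map_mat of_int B) q"
    unfolding eigenvalue_def eigenvector_def using B by (intro exI[of _ w]) (auto simp: w_def)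
  then have "poly (char_poly (map_mat of_int B)) q = 0" using eigenvalue_root_char_poly[OF B(2)] by simp
  then have "poly (map_poly of_int (char_poly B)) q = 0" by (simp add: of_int_hom.char_poly_hom[OF B(1)])
  moreover have "Polynomial.lead_coeff (char_poly B) = 1" using degree_monic_char_poly[OF B(1)] by simp
  ultimately show ?thesis unfolding algebraic_int_altdef_ipoly by blast
qed

section \<open>Schur's lemma and degrees of irreducible representations\<close>

text \<open>A homomorphism into \<open>GL n\<close> in terms of matrix multiplication, without the unit group of the matrix
  ring.\<close>

locale matrix_representation = Group.group G for G (structure) +
  fixes n :: nat and \<rho> :: "'a \<Rightarrow> complex mat"
  assumes rep_carrier: "g \<in> carrier G \<Longrightarrow> \<rho> g \<in> carrier_mat n n"
    and rep_mult: "g \<in> carrier G \<Longrightarrow> h \<in> carrier G \<Longrightarrow> \<rho> (g \<otimes> h) = \<rho> g * \<rho> h"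
    and rep_one: "\<rho> \<one> = 1\<^sub>m n"

locale irreducible_representation = matrix_representation +
  assumes degree_pos: "n > 0"
    and irreducible: "VectorSpace.subspace class_ring W (module_vec TYPE(complex) n) \<Longrightarrow>
      (\<forall>g \<in> carrier G. \<forall>w \<in> W. \<rho> g *\<^sub>v w \<in> W) \<Longrightarrow> W = {0\<^sub>v n} \<or> W = carrier_vec n"

lemma irreducible_representationI:
  assumes G: "Group.group G" and irr: "irreducible_rep G n \<rho>"
  shows "irreducible_representation G n \<rho>"
proof -
  interpret Group.group G by (rule G)
  have hom: "\<rho> \<in> hom G (GL n)" using irr by (simp add: irreducible_rep_def)
  have mon: "Group.monoid (ring_mat TYPE(complex) n ())" 
    using ring_mat[of n "()", where 'a = complex] by (simp add: Ring.ring_def)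
  have "\<rho> \<one>\<^bsub>G\<^esub> = \<one>\<^bsub>GL n\<^esub>"
    by (rule hom_one[OF hom G]) (simp add: GL_def monoid.units_group[OF mon])
  moreover have "\<rho> g \<in> carrier_mat n n" if "g \<in> carrier G" for g
  proof -
    have "\<rho> g \<in> Units (ring_mat TYPE(complex) n ())"
      using hom that by (auto simp: hom_def GL_def units_of_carrier)
    then show ?thesis using monoid.Units_closed[OF mon] by (simp add: ring_mat_simps)
  qed
  moreover have "\<rho> (g \<otimes>\<^bsub>G\<^esub> h) = \<rho> g * \<rho> h" if "g \<in> carrier G" "h \<in> carrier G" for g h
    using hom that by (simp add: hom_def GL_def units_of_mult ring_mat_simps)
  ultimately show ?thesis
    using irr by unfold_locales (simp_all add: GL_def units_of_one ring_mat_simps irreducible_rep_def)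
qed

lemma subspace_module_vecI:
  fixes W :: "complex vec set"
  assumes "W \<subseteq> carrier_vec n" "0\<^sub>v n \<in> W" "\<And>v w. v \<in> W \<Longrightarrow> w \<in> W \<Longrightarrow> v + w \<in> W"
    "\<And>c v. v \<in> W \<Longrightarrow> c \<cdot>\<^sub>v v \<in> W"
  shows "VectorSpace.subspace class_ring W (module_vec TYPE(complex) n)"
  unfolding VectorSpace.subspace_def LinearCombinations.submodule_def
  using assms vec_vs[of n, where 'a = complex] vec_module[of n, where 'a = complex]
  by (auto simp: module_vec_simps)

context matrix_representation
begin

lemma rep_pow: "g \<in> carrier G \<Longrightarrow> \<rho> (g [^] (k :: nat)) = \<rho> g ^\<^sub>m k"
proof (induction k)
  case 0
  then show ?case using rep_carrier[of g] by (simp add: rep_one)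
qed (simp add: rep_mult)

lemma rep_inv: "g \<in> carrier G \<Longrightarrow> \<rho> (inv g) * \<rho> g = 1\<^sub>m n"
  by (simp add: rep_mult[symmetric] rep_one)

lemma rep_eigenvalues:
  assumes fin: "finite (carrier G)" and g: "g \<in> carrier G"
  obtains es where "length es = n" "\<And>e. e \<in> set es \<Longrightarrow> e ^ Coset.order G = 1"
    "\<And>k :: nat. mat_trace (\<rho> (g [^] k)) = (\<Sum>e\<leftarrow>es. e ^ k)"
    "(\<forall>e \<in> set es. e = 1) \<Longrightarrow> \<rho> g = 1\<^sub>m n"
proof -
  have "\<rho> g ^\<^sub>m Coset.order G = 1\<^sub>m n"
    using rep_pow[OF g, of "Coset.order G"] pow_order_eq_1[OF g] rep_one by simp
  moreover have "Coset.order G > 0" using fin by (simp add: order_gt_0_iff_finite)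
  ultimately show ?thesis
    using finite_order_mat_eigenvalues[OF rep_carrier[OF g]] that rep_pow[OF g] by metis
qed

lemma trace_one: "mat_trace (\<rho> \<one>) = of_nat n"
  by (simp add: rep_one mat_trace_def)

text \<open>The trace is a sum of \<open>n\<close> roots of unity, and such a sum equals \<open>n\<close> only if all of them are \<open>1\<close>.\<close>

lemma trace_eq_degree_iff:
  assumes fin: "finite (carrier G)" and g: "g \<in> carrier G"
  shows "mat_trace (\<rho> g) = of_nat n \<longleftrightarrow> \<rho> g = 1\<^sub>m n"
proof
  assume tr: "mat_trace (\<rho> g) = of_nat n"
  obtain es where es: "length es = n" "\<And>e. e \<in> set es \<Longrightarrow> e ^ Coset.order G = 1"
    "\<And>k :: nat. mat_trace (\<rho> (g [^] k)) = (\<Sum>e\<leftarrow>es. e ^ k)"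
    "(\<forall>e \<in> set es. e = 1) \<Longrightarrow> \<rho> g = 1\<^sub>m n"
    using rep_eigenvalues[OF fin g] by blast
  have pos: "Coset.order G > 0" using fin by (simp add: order_gt_0_iff_finite)
  have "sum_list es = of_nat (length es)" using es(3)[of 1] tr es(1) g by simp
  then have "\<forall>e \<in> set es. e = 1"
    using sum_list_of_unit_complex[of es] norm_root_of_unity[OF es(2) pos] by blast
  then show "\<rho> g = 1\<^sub>m n" by (rule es(4))
qed (simp add: mat_trace_def)

lemma char_kernel_eq:
  assumes "finite (carrier G)"
  shows "char_kernel G (character G \<rho>) = {g \<in> carrier G. \<rho> g = 1\<^sub>m n}"
proof -
  have "character G \<rho> \<one> = of_nat n" using trace_one by (simp add: character_def)
  then show ?thesis
    using trace_eq_degree_iff[OF assms] by (auto simp: char_kernel_def) (simp_all add: character_def trace_one[unfolded rep_one])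
qed

lemma char_kernel_normal:
  assumes "finite (carrier G)"
  shows "char_kernel G (character G \<rho>) \<lhd> G"
proof -
  have inv1: "\<rho> (inv g) = 1\<^sub>m n" if "g \<in> carrier G" "\<rho> g = 1\<^sub>m n" for g
    using rep_inv[OF that(1)] rep_carrier[of "inv g"] that by simp
  have "subgroup (char_kernel G (character G \<rho>)) G"
    unfolding char_kernel_eq[OF assms]
    by (rule subgroupI) (auto simp: rep_one rep_mult inv1)
  moreover have "\<rho> (x \<otimes> g \<otimes> inv x) = 1\<^sub>m n" if "x \<in> carrier G" "g \<in> carrier G" "\<rho> g = 1\<^sub>m n" for x g
  proof -
    have "\<rho> (x \<otimes> g \<otimes> inv x) = \<rho> x * \<rho> (inv x)"
      using that rep_carrier[of x] by (simp add: rep_mult)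
    also have "\<dots> = 1\<^sub>m n" using that by (simp add: rep_mult[symmetric] rep_one)
    finally show ?thesis .
  qed
  ultimately show ?thesis
    by (simp add: normal_inv_iff) (simp add: char_kernel_eq[OF assms])
qed

end

context irreducible_representation
begin

text \<open>An eigenspace of a commuting matrix is an invariant subspace that is not zero, hence everything.\<close>

lemma schur:
  assumes M: "M \<in> carrier_mat n n" and comm: "\<And>g. g \<in> carrier G \<Longrightarrow> \<rho> g * M = M * \<rho> g"
  shows "\<exists>c. M = c \<cdot>\<^sub>m 1\<^sub>m n"
proof -
  obtain c where c: "eigenvalue M c" using spectrum_non_empty[OF M degree_pos] by (auto simp: spectrum_def)
  define W where "W = {w \<in> carrier_vec n. M *\<^sub>v w = c \<cdot>\<^sub>v w}"
  have "VectorSpace.subspace class_ring W (module_vec TYPE(complex) n)"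
  proof (rule subspace_module_vecI)
    show "v + w \<in> W" if "v \<in> W" "w \<in> W" for v w
      using that M by (auto simp: W_def mult_add_distrib_mat_vec smult_add_distrib_vec)
    show "a \<cdot>\<^sub>v v \<in> W" if "v \<in> W" for a v
      using that M by (auto simp: W_def mult_mat_vec smult_smult_assoc mult.commute)
  qed (use M in \<open>auto simp: W_def\<close>)
  moreover have "\<rho> g *\<^sub>v w \<in> W" if g: "g \<in> carrier G" and w: "w \<in> W" for g w
  proof -
    have R: "\<rho> g \<in> carrier_mat n n" by (rule rep_carrier[OF g])
    have wc: "w \<in> carrier_vec n" "M *\<^sub>v w = c \<cdot>\<^sub>v w" using w by (auto simp: W_def)
    have "M *\<^sub>v (\<rho> g *\<^sub>v w) = (M * \<rho> g) *\<^sub>v w" using M R wc by simp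
    also have "\<dots> = \<rho> g *\<^sub>v (M *\<^sub>v w)" using M R wc(1) comm[OF g, symmetric] by simp
    also have "\<dots> = c \<cdot>\<^sub>v (\<rho> g *\<^sub>v w)" unfolding wc(2) using R wc(1) by (rule mult_mat_vec)
    finally show ?thesis using R wc by (simp add: W_def)
  qed
  ultimately have "W = {0\<^sub>v n} \<or> W = carrier_vec n" by (intro irreducible) auto
  moreover obtain v where "v \<in> carrier_vec n" "v \<noteq> 0\<^sub>v n" "M *\<^sub>v v = c \<cdot>\<^sub>v v"
    using c M unfolding eigenvalue_def eigenvector_def by auto
  ultimately have W: "W = carrier_vec n" by (auto simp: W_def)
  have "M = c \<cdot>\<^sub>m 1\<^sub>m n"
  proof (rule eq_matI)
    fix i j assume ij: "i < dim_row (c \<cdot>\<^sub>m 1\<^sub>m n)" "j < dim_col (c \<cdot>\<^sub>m 1\<^sub>m n)"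
    have "M *\<^sub>v unit_vec n j = c \<cdot>\<^sub>v unit_vec n j"
    proof -
      have "unit_vec n j \<in> W" unfolding W by simp
      then show ?thesis by (simp add: W_def)
    qed
    then have "(M *\<^sub>v unit_vec n j) $ i = (c \<cdot>\<^sub>v unit_vec n j) $ i" by (rule arg_cong)
    moreover have "(M *\<^sub>v unit_vec n j) $ i = M $$ (i, j)"
      using ij M by (simp add: scalar_prod_right_unit)
    ultimately show "M $$ (i, j) = (c \<cdot>\<^sub>m 1\<^sub>m n) $$ (i, j)" using ij by simp
  qed (use M in auto)
  then show ?thesis ..
qed

lemma rep_mult_entry:
  assumes "g \<in> carrier G" "h \<in> carrier G" "i < n" "j < n"
  shows "\<rho> (g \<otimes> h) $$ (i, j) = (\<Sum>k<n. \<rho> g $$ (i, k) * \<rho> h $$ (k, j))"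
  using assms rep_carrier[of g] rep_carrier[of h]
  by (simp add: rep_mult scalar_prod_def atLeast0LessThan)

text \<open>For fixed \<open>i\<close> and \<open>j\<close> the left-hand sides form the matrix obtained by averaging the elementary
  matrix \<open>E(i, j)\<close> over the group by conjugation.  This commutes with the representation, so it is
  scalar, and its trace determines the scalar.\<close>

lemma schur_orthogonality:
  assumes fin: "finite (carrier G)" and "i < n" "j < n" "k < n" "l < n"
  shows "(\<Sum>g\<in>carrier G. \<rho> g $$ (k, i) * \<rho> (inv g) $$ (j, l))
    = (if i = j \<and> k = l then of_nat (Coset.order G) / of_nat n else 0)"
proof -
  define M where "M = mat n n (\<lambda>(k, l). \<Sum>g\<in>carrier G. \<rho> g $$ (k, i) * \<rho> (inv g) $$ (j, l))"
  have M: "M \<in> carrier_mat n n" by (simp add: M_def)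
  have "\<exists>c. M = c \<cdot>\<^sub>m 1\<^sub>m n"
  proof (rule schur[OF M])
    fix h assume h: "h \<in> carrier G"
    note R = rep_carrier[OF h]
    show "\<rho> h * M = M * \<rho> h"
    proof (rule eq_matI)
      fix a b assume "a < dim_row (M * \<rho> h)" "b < dim_col (M * \<rho> h)"
      then have ab: "a < n" "b < n" using M R by auto
      have "(\<rho> h * M) $$ (a, b) = (\<Sum>k<n. \<rho> h $$ (a, k) * (\<Sum>g\<in>carrier G. \<rho> g $$ (k, i) * \<rho> (inv g) $$ (j, b)))"
        using ab R by (simp add: M_def scalar_prod_def atLeast0LessThan)
      also have "\<dots> = (\<Sum>g\<in>carrier G. (\<Sum>k<n. \<rho> h $$ (a, k) * \<rho> g $$ (k, i)) * \<rho> (inv g) $$ (j, b))"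
        by (simp add: sum_distrib_left sum_distrib_right mult.assoc) (rule sum.swap)
      also have "\<dots> = (\<Sum>g\<in>carrier G. \<rho> (h \<otimes> g) $$ (a, i) * \<rho> (inv g) $$ (j, b))"
        using h ab assms by (simp add: rep_mult_entry)
      also have "\<dots> = (\<Sum>g\<in>carrier G. \<rho> (h \<otimes> g) $$ (a, i) * \<rho> (inv (h \<otimes> g) \<otimes> h) $$ (j, b))"
        using h by (intro sum.cong refl) (simp add: inv_mult_group m_assoc)
      also have "\<dots> = (\<Sum>g\<in>carrier G. \<rho> g $$ (a, i) * \<rho> (inv g \<otimes> h) $$ (j, b))"
      proof (rule sum.reindex_bij_betw)
        show "bij_betw (\<lambda>g. h \<otimes> g) (carrier G) (carrier G)"
          using h by (intro bij_betw_byWitness[where f' = "\<lambda>g. inv h \<otimes> g"]) (auto simp: m_assoc[symmetric])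
      qed
      also have "\<dots> = (\<Sum>g\<in>carrier G. \<rho> g $$ (a, i) * (\<Sum>k<n. \<rho> (inv g) $$ (j, k) * \<rho> h $$ (k, b)))"
        using h ab assms by (simp add: rep_mult_entry)
      also have "\<dots> = (\<Sum>k<n. (\<Sum>g\<in>carrier G. \<rho> g $$ (a, i) * \<rho> (inv g) $$ (j, k)) * \<rho> h $$ (k, b))"
        by (simp add: sum_distrib_left sum_distrib_right mult.assoc) (rule sum.swap)
      also have "\<dots> = (M * \<rho> h) $$ (a, b)"
        using ab R by (simp add: M_def scalar_prod_def atLeast0LessThan)
      finally show "(\<rho> h * M) $$ (a, b) = (M * \<rho> h) $$ (a, b)" .
    qed (use M R in auto)
  qed
  then obtain c where c: "M = c \<cdot>\<^sub>m 1\<^sub>m n" ..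
  have ent: "(\<Sum>g\<in>carrier G. \<rho> g $$ (k, i) * \<rho> (inv g) $$ (j, l)) = (if k = l then c else 0)"
    if "k < n" "l < n" for k l
    using arg_cong[OF c, of "\<lambda>A. A $$ (k, l)"] that by (simp add: M_def)
  have "of_nat n * c = (\<Sum>k<n. \<Sum>g\<in>carrier G. \<rho> g $$ (k, i) * \<rho> (inv g) $$ (j, k))"
    by (simp add: ent)
  also have "\<dots> = (\<Sum>g\<in>carrier G. \<Sum>k<n. \<rho> (inv g) $$ (j, k) * \<rho> g $$ (k, i))"
    by (subst sum.swap) (simp add: mult.commute)
  also have "\<dots> = (\<Sum>g\<in>carrier G. \<rho> (inv g \<otimes> g) $$ (j, i))"
    using assms by (intro sum.cong refl rep_mult_entry[symmetric]) auto
  also have "\<dots> = (\<Sum>g\<in>carrier G. if i = j then 1 else 0)"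
    using assms by (intro sum.cong refl) (simp add: rep_one)
  also have "\<dots> = (if i = j then of_nat (Coset.order G) else 0)" by (simp add: Coset.order_def)
  finally have "c = (if i = j then of_nat (Coset.order G) / of_nat n else 0)"
    using degree_pos by (auto simp: field_simps split: if_splits)
  then show ?thesis using ent[OF assms(4,5)] by auto
qed

text \<open>The class function \<open>g \<mapsto> \<chi>(g\<^sup>-\<^sup>1)\<close> acts on the representation as the scalar \<open>|G| / n\<close>.\<close>

lemma sum_character_rep:
  assumes fin: "finite (carrier G)" and "k < n" "i < n"
  shows "(\<Sum>g\<in>carrier G. mat_trace (\<rho> (inv g)) * \<rho> g $$ (k, i))
    = (if k = i then of_nat (Coset.order G) / of_nat n else 0)"
proof -
  have "(\<Sum>g\<in>carrier G. mat_trace (\<rho> (inv g)) * \<rho> g $$ (k, i))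
    = (\<Sum>g\<in>carrier G. \<Sum>j<n. \<rho> g $$ (k, i) * \<rho> (inv g) $$ (j, j))"
  proof (rule sum.cong[OF refl])
    fix g assume "g \<in> carrier G"
    then have "dim_row (\<rho> (inv g)) = n" using rep_carrier[of "inv g"] by simp
    then show "mat_trace (\<rho> (inv g)) * \<rho> g $$ (k, i) = (\<Sum>j<n. \<rho> g $$ (k, i) * \<rho> (inv g) $$ (j, j))"
      by (simp add: mat_trace_def sum_distrib_left mult.commute)
  qed
  also have "\<dots> = (\<Sum>j<n. \<Sum>g\<in>carrier G. \<rho> g $$ (k, i) * \<rho> (inv g) $$ (j, j))" by (rule sum.swap)
  also have "\<dots> = (\<Sum>j<n. if j = i then (if k = i then of_nat (Coset.order G) / of_nat n else 0) else 0)"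
    using assms by (intro sum.cong refl) (subst schur_orthogonality[OF fin]; auto)
  also have "\<dots> = (if k = i then of_nat (Coset.order G) / of_nat n else 0)" using assms by simp
  finally show ?thesis .
qed

text \<open>By \<open>sum_character_rep\<close> the rational number \<open>|G| / n\<close> is an integral combination of roots of unity
  times group elements.  Hence multiplication by it preserves the integer span of the finitely many
  numbers \<open>\<zeta> * \<rho>(g)(0, 0)\<close>, where \<open>\<zeta>\<close> is a root of unity of order dividing \<open>|G|\<close>.  So it is an
  algebraic integer, and being rational it is an integer.\<close>

theorem degree_dvd_order:
  assumes fin: "finite (carrier G)"
  shows "n dvd Coset.order G"
proof -
  let ?N = "Coset.order G"
  let ?q = "of_nat ?N / of_nat n :: complex"
  have N: "?N > 0" using fin by (simp add: order_gt_0_iff_finite)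
  let ?S = "{z :: complex. z ^ ?N = 1} \<times> carrier G"
  define v where "v = (\<lambda>(z :: complex, g). z * \<rho> g $$ (0, 0))"
  have S: "finite ?S" using fin N by (simp add: finite_roots_unity)
  have "algebraic_int ?q"
  proof (rule algebraic_int_if_int_span_stable[OF S])
    show "(1, \<one>) \<in> ?S" "v (1, \<one>) \<noteq> 0" using degree_pos by (auto simp: v_def rep_one)
    fix s assume "s \<in> ?S"
    then obtain z h where s: "s = (z, h)" and z: "z ^ ?N = 1" and h: "h \<in> carrier G" by auto
    have "?q * \<rho> h $$ (0, 0) = (\<Sum>k<n. (if 0 = k then ?q else 0) * \<rho> h $$ (k, 0))"
      using degree_pos by (simp add: if_distrib[of "\<lambda>x. x * _"] cong: if_cong)
    also have "\<dots> = (\<Sum>k<n. (\<Sum>g\<in>carrier G. mat_trace (\<rho> (inv g)) * \<rho> g $$ (0, k)) * \<rho> h $$ (k, 0))"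
      using degree_pos by (intro sum.cong refl) (simp only: sum_character_rep[OF fin] lessThan_iff)
    also have "\<dots> = (\<Sum>g\<in>carrier G. mat_trace (\<rho> (inv g)) * (\<Sum>k<n. \<rho> g $$ (0, k) * \<rho> h $$ (k, 0)))"
      by (simp add: sum_distrib_left sum_distrib_right mult.assoc) (rule sum.swap)
    also have "\<dots> = (\<Sum>g\<in>carrier G. mat_trace (\<rho> (inv g)) * \<rho> (g \<otimes> h) $$ (0, 0))"
      using h degree_pos by (simp add: rep_mult_entry)
    finally have "?q * v s = (\<Sum>g\<in>carrier G. z * (mat_trace (\<rho> (inv g)) * \<rho> (g \<otimes> h) $$ (0, 0)))"
      by (simp add: s v_def sum_distrib_left[symmetric] algebra_simps)
    also have "\<dots> \<in> int_span v ?S"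
    proof (rule int_span_sum)
      fix g assume g: "g \<in> carrier G"
      then obtain es where es: "\<And>e. e \<in> set es \<Longrightarrow> e ^ ?N = 1" "\<And>k :: nat. mat_trace (\<rho> (inv g [^] k)) = (\<Sum>e\<leftarrow>es. e ^ k)"
        using rep_eigenvalues[OF fin, of "inv g"] by (metis inv_closed)
      have "mat_trace (\<rho> (inv g)) = sum_list es" using es(2)[of 1] g by simp
      then have "z * (mat_trace (\<rho> (inv g)) * \<rho> (g \<otimes> h) $$ (0, 0)) = (\<Sum>e\<leftarrow>es. v (z * e, g \<otimes> h))"
        by (simp add: v_def sum_list_const_mult sum_list_mult_const mult.assoc)
      moreover have "(\<Sum>e\<leftarrow>es. v (z * e, g \<otimes> h)) \<in> int_span v ?S"
        using es(1) z g h by (intro int_span_sum_list int_span_generator[OF S]) (auto simp: power_mult_distrib)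
      ultimately show "z * (mat_trace (\<rho> (inv g)) * \<rho> (g \<otimes> h) $$ (0, 0)) \<in> int_span v ?S" by simp
    qed
    finally show "?q * v s \<in> int_span v ?S" .
  qed
  moreover have "?q \<in> \<rat>" by (intro Rats_divide Rats_of_nat)
  ultimately have "?q \<in> \<int>" by (rule rational_algebraic_int_is_int)
  then obtain m where m: "?q = of_int m" by (auto elim: Ints_cases)
  then have "(of_nat ?N :: complex) = of_int m * of_nat n" using degree_pos by (simp add: field_simps)
  then have "int ?N = m * int n" by (metis of_int_eq_iff of_int_mult of_int_of_nat_eq)
  then have "int n dvd int ?N" by simp
  then show ?thesis by simp
qed

lemma central_scalar:
  assumes "z \<in> group_center G"
  obtains c where "\<rho> z = c \<cdot>\<^sub>m 1\<^sub>m n"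
proof -
  have z: "z \<in> carrier G" "\<And>g. g \<in> carrier G \<Longrightarrow> z \<otimes> g = g \<otimes> z" using assms by (auto simp: group_center_def)
  have "\<exists>c. \<rho> z = c \<cdot>\<^sub>m 1\<^sub>m n"
    by (rule schur[OF rep_carrier[OF z(1)]]) (metis rep_mult z)
  then show thesis using that by blast
qed

end

section \<open>Central elements of p-groups\<close>

context Group.group
begin

lemma subgroup_group_center: "subgroup (group_center G) G"
proof (rule subgroupI)
  show "inv a \<in> group_center G" if a: "a \<in> group_center G" for a
  proof -
    have a': "a \<in> carrier G" "\<And>g. g \<in> carrier G \<Longrightarrow> a \<otimes> g = g \<otimes> a"
      using a by (auto simp: group_center_def)
    have "inv a \<otimes> g = g \<otimes> inv a" if g: "g \<in> carrier G" for g
    proof -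
      have "inv a \<otimes> g = inv a \<otimes> (g \<otimes> a) \<otimes> inv a" using a' g by (simp add: m_assoc)
      also have "\<dots> = inv a \<otimes> (a \<otimes> g) \<otimes> inv a" using a'(2)[OF g] by simp
      also have "\<dots> = g \<otimes> inv a" using a'(1) g by (simp add: m_assoc[symmetric])
      finally show ?thesis .
    qed
    then show ?thesis using a' by (simp add: group_center_def)
  qed
  show "a \<otimes> b \<in> group_center G" if "a \<in> group_center G" "b \<in> group_center G" for a b
  proof -
    have ab: "a \<in> carrier G" "b \<in> carrier G"
      and a: "\<And>g. g \<in> carrier G \<Longrightarrow> a \<otimes> g = g \<otimes> a"
      and b: "\<And>g. g \<in> carrier G \<Longrightarrow> b \<otimes> g = g \<otimes> b"
      using that by (auto simp: group_center_def)
    have "a \<otimes> b \<otimes> g = g \<otimes> (a \<otimes> b)" if g: "g \<in> carrier G" for g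
    proof -
      have "a \<otimes> b \<otimes> g = a \<otimes> (g \<otimes> b)" using ab g b[OF g] by (simp add: m_assoc)
      also have "\<dots> = g \<otimes> (a \<otimes> b)" using ab g a[OF g] by (simp add: m_assoc[symmetric])
      finally show ?thesis .
    qed
    then show ?thesis using ab by (simp add: group_center_def)
  qed
qed (auto simp: group_center_def)

lemma subgroup_nat_pow_closed:
  assumes "subgroup H G" "x \<in> H" shows "x [^] (m :: nat) \<in> H"
  using assms by (induction m) (auto intro: subgroup.one_closed subgroup.m_closed)

text \<open>Conjugacy class counting: the order of \<open>N\<close> is divisible by \<open>p\<close> and is a sum of class sizes, which are
  powers of \<open>p\<close>.  The class of the identity has size one, so another class of size one must occur.\<close>

lemma p_group_normal_meets_center:
  assumes p: "Factorial_Ring.prime p" and fin: "finite (carrier G)" and ord: "Coset.order G = p ^ k"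
    and N: "N \<lhd> G" and nt: "N \<noteq> {\<one>}"
  obtains z where "z \<in> N" "z \<in> group_center G" "z \<noteq> \<one>"
proof -
  define \<phi> where "\<phi> = (\<lambda>g. \<lambda>h \<in> carrier G. g \<otimes> h \<otimes> inv g)"
  interpret act: group_action G "carrier G" \<phi> unfolding \<phi>_def by (rule action_by_conjugation)
  define cl where "cl x = orbit G \<phi> x" for x
  have cl: "cl x = (\<lambda>g. g \<otimes> x \<otimes> inv g) ` carrier G" if "x \<in> carrier G" for x
    using that by (auto simp: cl_def orbit_def \<phi>_def)
  have sub: "subgroup N G" using N by (simp add: normal_imp_subgroup)
  have NG: "N \<subseteq> carrier G" using sub by (rule subgroup.subset)
  have finN: "finite N" using finite_subset[OF NG fin] .
  have ON: "cl x \<subseteq> N" if xN: "x \<in> N" for x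
  proof
    fix y assume "y \<in> cl x"
    then obtain g where "g \<in> carrier G" "y = g \<otimes> x \<otimes> inv g" using cl[OF subsetD[OF NG xN]] by auto
    then show "y \<in> N" using normal.inv_op_closed2[OF N, of g x] xN by simp
  qed
  have refl: "x \<in> cl x" if "x \<in> N" for x using act.orbit_refl[OF subsetD[OF NG that]] unfolding cl_def .
  have O1: "cl \<one> = {\<one>}"
    using cl[OF one_closed] by auto
  have cardO: "card (cl x) dvd p ^ k" if "x \<in> N" for x
  proof -
    have "card (cl x) * card (stabilizer G \<phi> x) = p ^ k"
      using act.orbit_stabilizer_theorem[OF subsetD[OF NG that]] ord unfolding cl_def by (rule trans)
    then show ?thesis by (metis dvd_triv_left)
  qed
  have card1: "x \<in> group_center G" if x: "x \<in> N" and c: "card (cl x) = 1" for x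
  proof -
    have xG: "x \<in> carrier G" using x NG by blast
    have O: "cl x = {x}" using c refl[OF x] by (metis card_1_singletonE singletonD)
    have "x \<otimes> g = g \<otimes> x" if g: "g \<in> carrier G" for g
    proof -
      have "g \<otimes> x \<otimes> inv g = x" using O cl[OF xG] g by blast
      then have "x \<otimes> g = g \<otimes> x \<otimes> inv g \<otimes> g" by simp
      also have "\<dots> = g \<otimes> x" using g xG by (simp add: m_assoc)
      finally show ?thesis .
    qed
    then show ?thesis using xG by (simp add: group_center_def)
  qed
  have p1: "p > 1" using p by (rule prime_gt_1_nat)
  have "\<exists>z\<in>N. z \<in> group_center G \<and> z \<noteq> \<one>"
  proof (rule ccontr)
    assume no: "\<not> ?thesis"
    have div: "p dvd card (cl x)" if x: "x \<in> N" "x \<noteq> \<one>" for x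
    proof -
      have "card (cl x) \<noteq> 1" using no x card1 by blast
      moreover obtain i where "card (cl x) = p ^ i" using cardO[OF x(1)] p by (auto simp: divides_primepow_nat)
      ultimately show ?thesis by (cases i) auto
    qed
    have N_un: "N = \<Union> (cl ` N)" using ON refl by blast
    have disj: "A \<inter> B = {}" if "A \<in> cl ` N" "B \<in> cl ` N" "A \<noteq> B" for A B
    proof -
      have "cl ` N \<subseteq> orbits G (carrier G) \<phi>" using NG unfolding orbits_def cl_def by blast
      then show ?thesis using act.disjoint_union that by blast
    qed
    have "card (\<Union> (cl ` N)) = (\<Sum>A\<in>cl ` N. card A)"
    proof (rule card_Union_disjoint)
      show "pairwise disjnt (cl ` N)" unfolding pairwise_def disjnt_def using disj by blast
      fix A assume "A \<in> cl ` N"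
      then obtain x where "x \<in> N" "A = cl x" by blast
      then show "finite A" using finite_subset[OF ON finN] by blast
    qed
    then have "card N = (\<Sum>A\<in>cl ` N. card A)" using N_un by simp
    also have "\<dots> = card {\<one>} + (\<Sum>A\<in>cl ` N - {{\<one>}}. card A)"
    proof -
      have "\<one> \<in> N" using sub by (rule subgroup.one_closed)
      then have "{\<one>} \<in> cl ` N" using O1 by (intro image_eqI[OF sym])
      then show ?thesis using finN by (intro sum.remove) auto
    qed
    finally have "card N = 1 + (\<Sum>A\<in>cl ` N - {{\<one>}}. card A)" by simp
    moreover have "p dvd (\<Sum>A\<in>cl ` N - {{\<one>}}. card A)"
    proof (rule dvd_sum)
      fix A assume A: "A \<in> cl ` N - {{\<one>}}"
      then obtain x where x: "x \<in> N" "A = cl x" by blast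
      have "x \<noteq> \<one>"
      proof
        assume "x = \<one>"
        then have "cl x = {\<one>}" using O1 by simp
        then show False using A x by blast
      qed
      then show "p dvd card A" using div x by simp
    qed
    moreover have "p dvd card N"
    proof -
      have "card N dvd p ^ k" using lagrange[OF sub] ord by (metis dvd_triv_right)
      then obtain i where i: "card N = p ^ i" using p by (auto simp: divides_primepow_nat)
      have "card N \<noteq> 1" using nt subgroup.one_closed[OF sub] by (metis card_1_singletonE singletonD)
      then show ?thesis using i by (cases i) auto
    qed
    ultimately have "p dvd 1" by (metis dvd_add_left_iff)
    then show False using p1 by simp
  qed
  then show thesis using that by blast
qed

text \<open>The last nontrivial element in the sequence of \<open>p\<close>-power powers of a central element.\<close>

lemma p_group_normal_central_order_p:
  assumes p: "Factorial_Ring.prime p" and fin: "finite (carrier G)" and ord: "Coset.order G = p ^ k"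
    and N: "N \<lhd> G" and nt: "N \<noteq> {\<one>}"
  obtains z where "z \<in> N" "z \<in> group_center G" "z \<noteq> \<one>" "z [^] p = \<one>"
proof -
  obtain z where z: "z \<in> N" "z \<in> group_center G" "z \<noteq> \<one>"
    using p_group_normal_meets_center[OF p fin ord N nt] by blast
  have zG: "z \<in> carrier G" using z by (simp add: group_center_def)
  define j where "j = (LEAST j. z [^] (p ^ j) = \<one>)"
  have "z [^] (p ^ k) = \<one>" using pow_order_eq_1[OF zG] ord by simp
  then have j: "z [^] (p ^ j) = \<one>" unfolding j_def by (rule LeastI)
  have "j \<noteq> 0" using j z zG by (intro notI) simp
  then obtain i where i: "j = Suc i" by (cases j) auto
  let ?y = "z [^] (p ^ i)"
  have "?y \<noteq> \<one>" using not_less_Least[of i "\<lambda>j. z [^] (p ^ j) = \<one>"] i unfolding j_def by auto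
  moreover have "?y [^] p = \<one>" using j zG by (simp add: i nat_pow_pow mult.commute)
  moreover have "?y \<in> N" "?y \<in> group_center G"
    using z subgroup_nat_pow_closed subgroup_group_center normal_imp_subgroup[OF N] by blast+
  ultimately show thesis using that by blast
qed

end

section \<open>The rank of a finite abelian p-group\<close>

context Group.comm_group
begin

lemma subgroup_power_image: "subgroup ((\<lambda>x. x [^] (p :: nat)) ` carrier G) G"
proof (rule subgroupI)
  fix a assume "a \<in> (\<lambda>x. x [^] p) ` carrier G"
  then obtain x where "x \<in> carrier G" "a = x [^] p" by blast
  then show "inv a \<in> (\<lambda>x. x [^] p) ` carrier G"
    by (intro image_eqI[of _ _ "inv x"]) (auto simp: nat_pow_inv)
next
  fix a b assume "a \<in> (\<lambda>x. x [^] p) ` carrier G" "b \<in> (\<lambda>x. x [^] p) ` carrier G"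
  then obtain x y where "x \<in> carrier G" "a = x [^] p" "y \<in> carrier G" "b = y [^] p" by blast
  then show "a \<otimes> b \<in> (\<lambda>x. x [^] p) ` carrier G"
    by (intro image_eqI[of _ _ "x \<otimes> y"]) (auto simp: nat_pow_distrib)
qed auto

text \<open>The \<open>p\<close>-th power map is an endomorphism, and a choice of preimages identifies the group with the
  product of its kernel and its image.\<close>

lemma card_torsion_times_power_image:
  "card {x \<in> carrier G. x [^] (p :: nat) = \<one>} * card ((\<lambda>x. x [^] p) ` carrier G) = Coset.order G"
proof -
  let ?T = "{x \<in> carrier G. x [^] p = \<one>}" and ?P = "(\<lambda>x. x [^] p) ` carrier G"
  define s where "s y = (SOME x. x \<in> carrier G \<and> x [^] p = y)" for y
  have s: "s y \<in> carrier G \<and> s y [^] p = y" if "y \<in> ?P" for y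
    unfolding s_def by (rule someI_ex) (use that in blast)
  define F where "F = (\<lambda>(t, y). t \<otimes> s y)"
  define F' where "F' x = (x \<otimes> inv (s (x [^] p)), x [^] p)" for x
  have "bij_betw F (?T \<times> ?P) (carrier G)"
  proof (rule bij_betw_byWitness[where f' = F'])
    show "\<forall>a\<in>?T \<times> ?P. F' (F a) = a"
    proof
      fix a assume "a \<in> ?T \<times> ?P"
      then obtain t y where a: "a = (t, y)" "t \<in> carrier G" "t [^] p = \<one>" "y \<in> ?P" by blast
      note sy = s[OF a(4)]
      have y: "y \<in> carrier G" using a(4) by auto
      have pw: "(t \<otimes> s y) [^] p = y" using a sy y by (simp add: nat_pow_distrib)
      show "F' (F a) = a" using a sy y by (simp add: F_def F'_def pw m_assoc)
    qed
    show "\<forall>x\<in>carrier G. F (F' x) = x"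
      using s by (auto simp: F_def F'_def m_assoc)
    show "F ` (?T \<times> ?P) \<subseteq> carrier G" using s by (auto simp: F_def)
    show "F' ` carrier G \<subseteq> ?T \<times> ?P"
    proof
      fix a assume "a \<in> F' ` carrier G"
      then obtain x where x: "x \<in> carrier G" "a = F' x" by blast
      have sx: "s (x [^] p) \<in> carrier G" "s (x [^] p) [^] p = x [^] p" using s x by blast+
      then have "(x \<otimes> inv (s (x [^] p))) [^] p = \<one>" using x by (simp add: nat_pow_distrib nat_pow_inv)
      then show "a \<in> ?T \<times> ?P" using x sx by (simp add: F'_def)
    qed
  qed
  then have "card (?T \<times> ?P) = card (carrier G)" by (rule bij_betw_same_card)
  then show ?thesis by (simp add: card_cartesian_product Coset.order_def)
qed

text \<open>Adjoining an element whose \<open>p\<close>-th power already lies in \<open>H\<close> gives the union of the cosets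
  \<open>x ^ i H\<close> with \<open>i < p\<close>.  These are distinct unless \<open>x \<in> H\<close>, because \<open>p\<close> is prime.\<close>

lemma generate_insert_card:
  assumes p: "Factorial_Ring.prime (p :: nat)" and fin: "finite (carrier G)" and S: "S \<subseteq> carrier G"
    and x: "x \<in> carrier G" and xp: "x [^] p \<in> generate G S"
  shows "card (generate G (insert x S)) \<le> p * card (generate G S)"
    and "x \<notin> generate G S \<Longrightarrow> card (generate G (insert x S)) = p * card (generate G S)"
proof -
  let ?H = "generate G S"
  have H: "subgroup ?H G" by (rule generate_is_subgroup[OF S])
  have HG: "h \<in> carrier G" if "h \<in> ?H" for h using that H subgroup.subset by blast
  have p0: "p > 0" using p by (rule prime_gt_0_nat)
  define f where "f = (\<lambda>(i :: nat, h). x [^] i \<otimes> h)"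
  let ?K = "f ` ({..<p} \<times> ?H)"
  have inK: "x [^] m \<otimes> h \<in> ?K" if h: "h \<in> ?H" for m :: nat and h
  proof -
    have "x [^] m = x [^] (m mod p) \<otimes> (x [^] p) [^] (m div p)"
      using x by (simp add: nat_pow_pow nat_pow_mult)
    then have "x [^] m \<otimes> h = f (m mod p, (x [^] p) [^] (m div p) \<otimes> h)"
      using x HG[OF h] by (simp add: f_def m_assoc)
    moreover have "(x [^] p) [^] (m div p) \<otimes> h \<in> ?H"
      using subgroup_nat_pow_closed[OF H xp] h subgroup.m_closed[OF H] by blast
    ultimately show ?thesis using p0 by force
  qed
  have K: "subgroup ?K G"
  proof (rule subgroupI)
    show "?K \<subseteq> carrier G" using x HG by (auto simp: f_def)
    show "?K \<noteq> {}" using inK subgroup.one_closed[OF H] by blast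
    fix a assume "a \<in> ?K"
    then obtain i h where a: "i < p" "h \<in> ?H" "a = x [^] i \<otimes> h" by (auto simp: f_def)
    have "inv (x [^] i) = x [^] (p - i) \<otimes> inv (x [^] p)"
    proof -
      have "x [^] p = x [^] i \<otimes> x [^] (p - i)" using x a by (simp add: nat_pow_mult)
      then show ?thesis using x by (simp add: inv_mult m_assoc[symmetric] m_comm[of _ "inv (x [^] i)"])
        (simp add: m_assoc)
    qed
    then have "inv a = x [^] (p - i) \<otimes> (inv (x [^] p) \<otimes> inv h)"
      using a x HG by (simp add: inv_mult m_assoc)
    moreover have "inv (x [^] p) \<otimes> inv h \<in> ?H"
      using xp a(2) H by (simp add: subgroup.m_closed subgroup.m_inv_closed)
    ultimately show "inv a \<in> ?K" using inK by simp
    fix b assume "b \<in> ?K"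
    then obtain q where q: "q \<in> {..<p} \<times> ?H" "b = f q" by blast
    obtain j h' where "q = (j, h')" by (cases q)
    with q have b: "h' \<in> ?H" "b = x [^] j \<otimes> h'" by (simp_all add: f_def)
    have "a \<otimes> b = x [^] (i + j) \<otimes> (h \<otimes> h')"
      using a b x HG by (simp add: nat_pow_mult[symmetric] m_ac)
    moreover have "h \<otimes> h' \<in> ?H" using a b H by (simp add: subgroup.m_closed)
    ultimately show "a \<otimes> b \<in> ?K" using inK by simp
  qed
  have "?K = generate G (insert x S)"
  proof (rule generateI[OF K])
    have "x = x [^] (1 :: nat) \<otimes> \<one>" using x by simp
    then have "x \<in> ?K" using inK[of \<one> 1] subgroup.one_closed[OF H] by metis
    moreover have "s \<in> ?K" if "s \<in> S" for s
      using inK[of s 0] generate.incl[OF that, of G] S that by auto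
    ultimately show "insert x S \<subseteq> ?K" by blast
    fix K' assume K': "subgroup K' G" "insert x S \<subseteq> K'"
    then have "?H \<subseteq> K'" by (intro generate_subgroup_incl) auto
    then show "?K \<subseteq> K'"
      using K' subgroup_nat_pow_closed[OF K'(1)] by (auto simp: f_def subgroup.m_closed)
  qed
  then have gen: "generate G (insert x S) = ?K" ..
  have finH: "finite ?H" using finite_subset[OF subgroup.subset[OF H] fin] .
  show "card (generate G (insert x S)) \<le> p * card ?H"
    unfolding gen using card_image_le[of "{..<p} \<times> ?H" f] finH by (simp add: card_cartesian_product)
  assume xH: "x \<notin> ?H"
  have "inj_on f ({..<p} \<times> ?H)"
  proof -
    have less: False if ij: "i < j" "j < p" and h: "h \<in> ?H" "h' \<in> ?H" and eq: "x [^] i \<otimes> h = x [^] j \<otimes> h'" for i j h h'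
    proof -
      have "x [^] j = x [^] i \<otimes> x [^] (j - i)" using x ij by (simp add: nat_pow_mult)
      then have "x [^] i \<otimes> h = x [^] i \<otimes> (x [^] (j - i) \<otimes> h')" using eq x HG[OF h(2)] by (simp add: m_assoc)
      then have "h = x [^] (j - i) \<otimes> h'" using x HG h by (simp add: l_cancel)
      then have "x [^] (j - i) = h \<otimes> inv h'" using x HG h by (simp add: m_assoc)
      then have 1: "x [^] (j - i) \<in> ?H" using h H by (simp add: subgroup.m_closed subgroup.m_inv_closed)
      have "\<not> p dvd j - i" using ij by (auto dest: dvd_imp_le)
      then have "gcd (j - i) p = 1" using prime_imp_power_coprime_nat[OF p, of "j - i" 1] by (simp add: coprime_iff_gcd_eq_1)
      moreover obtain u v where "(j - i) * u = p * v + gcd (j - i) p" using bezout_nat[of "j - i" p] ij by auto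
      ultimately have uv: "(j - i) * u = p * v + 1" by simp
      have "(x [^] (j - i)) [^] u = (x [^] p) [^] v \<otimes> x"
        using x by (simp add: nat_pow_pow uv del: One_nat_def) (simp add: nat_pow_mult[symmetric])
      then have "x = inv ((x [^] p) [^] v) \<otimes> (x [^] (j - i)) [^] u"
        using x by (simp add: m_assoc[symmetric])
      moreover have "inv ((x [^] p) [^] v) \<otimes> (x [^] (j - i)) [^] u \<in> ?H"
        using 1 xp H subgroup_nat_pow_closed[OF H] by (simp add: subgroup.m_closed subgroup.m_inv_closed)
      ultimately show False using xH by simp
    qed
    show ?thesis
    proof (rule inj_onI)
      fix a b assume ab: "a \<in> {..<p} \<times> ?H" "b \<in> {..<p} \<times> ?H" "f a = f b"
      obtain i h j h' where ih: "a = (i, h)" "b = (j, h')" by (metis surj_pair)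
      have eq: "x [^] i \<otimes> h = x [^] j \<otimes> h'" and mem: "i < p" "j < p" "h \<in> ?H" "h' \<in> ?H"
        using ab ih by (simp_all add: f_def)
      have "\<not> i < j" "\<not> j < i" using less[of i j h h'] less[of j i h' h] eq mem by auto
      then have "i = j" by simp
      then show "a = b" using ab ih x HG by (auto simp: f_def l_cancel)
    qed
  qed
  then show "card (generate G (insert x S)) = p * card ?H"
    unfolding gen by (simp add: card_image card_cartesian_product)
qed

text \<open>Let \<open>P\<close> be the group of \<open>p\<close>-th powers; the torsion subgroup has the order of the quotient by \<open>P\<close>.
  Adjoining generators to \<open>P\<close> one at a time multiplies the order by at most \<open>p\<close>, which bounds the
  torsion by \<open>p ^ d\<close>.  Conversely, a maximal set each of whose elements contributes a full factor
  \<open>p\<close> generates the group modulo \<open>P\<close>.  By iteration it generates the group modulo \<open>p ^ m\<close>-th powers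
  for all \<open>m\<close>, hence the group itself.\<close>

lemma card_torsion_eq_prime_power_rank:
  assumes p: "Factorial_Ring.prime (p :: nat)" and fin: "finite (carrier G)" and ord: "Coset.order G = p ^ k"
  shows "card {x \<in> carrier G. x [^] p = \<one>} = p ^ min_generators G"
proof -
  let ?T = "{x \<in> carrier G. x [^] p = \<one>}" and ?P = "(\<lambda>x. x [^] p) ` carrier G"
  have P: "subgroup ?P G" by (rule subgroup_power_image)
  have PG: "?P \<subseteq> carrier G" using P by (rule subgroup.subset)
  have cardP: "card ?P > 0" using fin P subgroup.one_closed by (metis card_gt_0_iff finite_imageI empty_iff)
  have p0: "p > 0" using p by (rule prime_gt_0_nat)
  have TP: "card ?T * card ?P = card (carrier G)"
    using card_torsion_times_power_image[of p] by (simp add: Coset.order_def)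
  have genP: "generate G ?P = ?P"
    using generateI[OF P subset_refl] by blast
  have pinc: "x [^] p \<in> generate G (S \<union> ?P)" if "x \<in> carrier G" for x S
    using that by (intro generate.incl) auto
  have upper: "card (generate G (S \<union> ?P)) \<le> p ^ card S * card ?P" if "finite S" "S \<subseteq> carrier G" for S
    using that
  proof (induction S)
    case empty
    then show ?case by (simp add: genP)
  next
    case (insert x S)
    then have "card (generate G (insert x (S \<union> ?P))) \<le> p * card (generate G (S \<union> ?P))"
      using PG pinc by (intro generate_insert_card(1)[OF p fin]) auto
    also have "\<dots> \<le> p * (p ^ card S * card ?P)" using insert by simp
    finally show ?case using insert by (simp add: mult.assoc)
  qed
  have le: "card ?T \<le> p ^ card S" if S: "finite S" "S \<subseteq> carrier G" "generate G S = carrier G" for S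
  proof -
    have "carrier G \<subseteq> generate G (S \<union> ?P)" using mono_generate[of S "S \<union> ?P"] S by auto
    moreover have "generate G (S \<union> ?P) \<subseteq> carrier G" using S PG by (intro generate_incl) auto
    ultimately have "generate G (S \<union> ?P) = carrier G" by blast
    then have "card ?T * card ?P \<le> p ^ card S * card ?P" using upper[OF S(1,2)] TP by simp
    then show ?thesis using cardP by simp
  qed
  let ?Q = "{S \<in> Pow (carrier G). card (generate G (S \<union> ?P)) = p ^ card S * card ?P}"
  have "finite ?Q" using fin by simp
  moreover have "?Q \<noteq> {}" using genP by (intro ex_in_conv[THEN iffD1] exI[of _ "{}"]) simp
  ultimately have "\<exists>S\<in>?Q. \<forall>b\<in>?Q. S \<subseteq> b \<longrightarrow> S = b" by (rule finite_has_maximal)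
  then obtain S where S: "S \<in> ?Q" and mx: "\<forall>b\<in>?Q. S \<subseteq> b \<longrightarrow> S = b" by (rule bexE)
  have maxS: "S = b" if "b \<in> ?Q" "S \<subseteq> b" for b using bspec[OF mx that(1)] that(2) by (rule mp)
  have SG: "S \<subseteq> carrier G" and finS: "finite S" using S fin finite_subset by auto
  have full: "generate G (S \<union> ?P) = carrier G"
  proof (rule ccontr)
    assume "generate G (S \<union> ?P) \<noteq> carrier G"
    moreover have "generate G (S \<union> ?P) \<subseteq> carrier G" using SG PG by (intro generate_incl) auto
    ultimately obtain x where x: "x \<in> carrier G" "x \<notin> generate G (S \<union> ?P)" by blast
    then have xS: "x \<notin> S" using generate.incl[of x "S \<union> ?P" G] by blast
    have "card (generate G (insert x (S \<union> ?P))) = p * card (generate G (S \<union> ?P))"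
      using SG PG pinc x by (intro generate_insert_card(2)[OF p fin]) auto
    then have "insert x S \<in> ?Q" using S x xS finS by simp
    then have "S = insert x S" using maxS[of "insert x S"] by (simp only: subset_insertI simp_thms)
    then show False using xS by blast
  qed
  let ?H = "generate G S"
  have H: "subgroup ?H G" by (rule generate_is_subgroup[OF SG])
  have HP: "subgroup (?H <#> ?P) G" by (rule mult_subgroups[OF H P])
  have "S \<union> ?P \<subseteq> ?H <#> ?P"
  proof
    fix s assume "s \<in> S \<union> ?P"
    then show "s \<in> ?H <#> ?P"
    proof
      assume "s \<in> S"
      then have "s \<in> ?H" "s = s \<otimes> \<one>" "\<one> \<in> ?P"
        using SG subgroup.one_closed[OF P] by (auto intro: generate.incl)
      then show ?thesis unfolding set_mult_def by blast
    next
      assume "s \<in> ?P"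
      then have "\<one> \<in> ?H" "s = \<one> \<otimes> s" "s \<in> ?P" using PG by (auto intro: generate.one)
      then show ?thesis unfolding set_mult_def by blast
    qed
  qed
  then have "carrier G \<subseteq> ?H <#> ?P" using generate_subgroup_incl[OF _ HP] full by blast
  then have dec: "\<exists>h\<in>?H. \<exists>y\<in>carrier G. c = h \<otimes> y [^] p" if "c \<in> carrier G" for c
    using that unfolding set_mult_def by blast
  have HG: "h \<in> carrier G" if "h \<in> ?H" for h using that H subgroup.subset by blast
  have dec_iter: "\<exists>h\<in>?H. \<exists>y\<in>carrier G. c = h \<otimes> y [^] (p ^ m)" if c: "c \<in> carrier G" for c and m :: nat
  proof (induction m)
    case 0
    show ?case using c generate.one[of G S] by (intro bexI[of _ \<one>] bexI[of _ c]) auto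
  next
    case (Suc m)
    then obtain h y where hy: "h \<in> ?H" "y \<in> carrier G" "c = h \<otimes> y [^] (p ^ m)" by blast
    obtain h' w where hw: "h' \<in> ?H" "w \<in> carrier G" "y = h' \<otimes> w [^] p" using dec[OF hy(2)] by blast
    have "c = (h \<otimes> h' [^] (p ^ m)) \<otimes> w [^] (p ^ Suc m)"
      unfolding hy(3) hw(3) using hy(1) hw(1,2) HG
      by (simp add: nat_pow_distrib nat_pow_pow m_assoc)
    moreover have "h \<otimes> h' [^] (p ^ m) \<in> ?H"
      using hy hw H subgroup_nat_pow_closed[OF H] by (simp add: subgroup.m_closed)
    ultimately show ?case using hw by blast
  qed
  have "carrier G \<subseteq> ?H"
  proof
    fix c assume "c \<in> carrier G"
    then obtain h y where hy: "h \<in> ?H" "y \<in> carrier G" "c = h \<otimes> y [^] (p ^ k)" using dec_iter by blast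
    then have "c = h" using pow_order_eq_1[of y] ord HG by simp
    then show "c \<in> ?H" using hy by simp
  qed
  then have genS: "generate G S = carrier G" using subgroup.subset[OF H] by blast
  have "card ?T * card ?P = p ^ card S * card ?P" using S full TP by simp
  then have TS: "card ?T = p ^ card S" using cardP by simp
  let ?R = "\<lambda>n. \<exists>S \<subseteq> carrier G. finite S \<and> card S = n \<and> generate G S = carrier G"
  have ex: "?R (card S)" using SG finS genS by blast
  have "?R (min_generators G)" unfolding min_generators_def by (rule LeastI[of ?R, OF ex])
  then obtain S' where S': "S' \<subseteq> carrier G" "finite S'" "card S' = min_generators G" "generate G S' = carrier G"
    by (elim exE conjE)
  have "card ?T \<le> p ^ min_generators G" using le[OF S'(2,1,4)] unfolding S'(3) .
  moreover have "min_generators G \<le> card S" unfolding min_generators_def by (rule Least_le[of ?R, OF ex])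
  then have "p ^ min_generators G \<le> card ?T" unfolding TS using p0 by (intro power_increasing) auto
  ultimately show ?thesis by simp
qed

end

text \<open>Equal rank gives equally many elements with trivial \<open>p\<close>-th power in the centre and in its
  intersection with the derived subgroup, and the latter are among the former.\<close>

lemma (in Group.group) central_torsion_subset_derived:
  assumes p: "Factorial_Ring.prime p" and fin: "finite (carrier G)" and ord: "Coset.order G = p ^ k"
    and rank: "min_generators (G\<lparr>carrier := group_center G \<inter> derived G (carrier G)\<rparr>)
           = min_generators (G\<lparr>carrier := group_center G\<rparr>)"
    and z: "z \<in> group_center G" "z [^] p = \<one>"
  shows "z \<in> derived G (carrier G)"
proof -
  let ?Z = "group_center G" and ?B = "group_center G \<inter> derived G (carrier G)"
  have Z: "subgroup ?Z G" by (rule subgroup_group_center)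
  have D: "subgroup (derived G (carrier G)) G" by (intro derived_is_subgroup) simp
  have B: "subgroup ?B G" using subgroups_Inter_pair[OF Z D] .
  have tors: "card {x \<in> A. x [^] p = \<one>} = p ^ min_generators (G\<lparr>carrier := A\<rparr>)"
    if A: "subgroup A G" "A \<subseteq> ?Z" for A
  proof -
    have AG: "A \<subseteq> carrier G" by (rule subgroup.subset[OF A(1)])
    have comm: "comm_group (G\<lparr>carrier := A\<rparr>)"
    proof (rule group.group_comm_groupI[OF subgroup_imp_group[OF A(1)]])
      fix x y assume "x \<in> carrier (G\<lparr>carrier := A\<rparr>)" "y \<in> carrier (G\<lparr>carrier := A\<rparr>)"
      then show "x \<otimes>\<^bsub>G\<lparr>carrier := A\<rparr>\<^esub> y = y \<otimes>\<^bsub>G\<lparr>carrier := A\<rparr>\<^esub> x"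
        using A(2) AG by (auto simp: group_center_def)
    qed
    have "card A dvd p ^ k" using lagrange[OF A(1)] ord by (metis dvd_triv_right)
    then obtain i where "card A = p ^ i" using p by (auto simp: divides_primepow_nat)
    then have "Coset.order (G\<lparr>carrier := A\<rparr>) = p ^ i" by (simp add: Coset.order_def)
    from comm_group.card_torsion_eq_prime_power_rank[OF comm p _ this]
    show ?thesis using finite_subset[OF AG fin] by (simp add: nat_pow_consistent[symmetric])
  qed
  have "{x \<in> ?B. x [^] p = \<one>} = {x \<in> ?Z. x [^] p = \<one>}"
  proof (rule card_subset_eq)
    show "finite {x \<in> ?Z. x [^] p = \<one>}" using finite_subset[OF subgroup.subset[OF Z] fin] by simp
    show "card {x \<in> ?B. x [^] p = \<one>} = card {x \<in> ?Z. x [^] p = \<one>}"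
      using tors[OF Z] tors[OF B] rank by simp
  qed auto
  then show ?thesis using z by blast
qed

section \<open>Galois orbit sums of the characters of a p-group\<close>

text \<open>Representatives of the units modulo \<open>p ^ (j + 1)\<close>, which index the automorphisms of the cyclotomic
  field.\<close>

definition coprime_residues :: "nat \<Rightarrow> nat \<Rightarrow> nat set" where
  "coprime_residues p j = {u. u < p ^ Suc j \<and> \<not> p dvd u}"

lemma geometric_sum_root_of_unity:
  fixes e :: complex
  assumes "e ^ m = 1"
  shows "(\<Sum>u<m. e ^ u) = (if e = 1 then of_nat m else 0)"
proof (cases "e = 1")
  case False
  have "(e - 1) * (\<Sum>u<m. e ^ u) = e ^ m - 1" by (simp only: power_diff_1_eq)
  then show ?thesis using False assms by simp
qed simp

text \<open>The sum over all residues minus the sum over the multiples of \<open>p\<close>; both are geometric.\<close>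

lemma ramanujan_sum_prime_power:
  fixes e :: complex
  assumes p: "Factorial_Ring.prime p" and e: "e ^ (p ^ Suc j) = 1"
  shows "(\<Sum>u\<in>coprime_residues p j. e ^ u) =
    (if e = 1 then of_nat (p ^ Suc j) else 0) - (if e ^ p = 1 then of_nat (p ^ j) else 0)"
proof -
  have p0: "p > 0" using p by (rule prime_gt_0_nat)
  let ?M = "(\<lambda>v. p * v) ` {..<p ^ j}"
  have M: "?M = {u. u < p ^ Suc j \<and> p dvd u}"
  proof
    show "{u. u < p ^ Suc j \<and> p dvd u} \<subseteq> ?M"
    proof
      fix u assume "u \<in> {u. u < p ^ Suc j \<and> p dvd u}"
      then obtain v where "u = p * v" "p * v < p * p ^ j" by (auto elim!: dvdE)
      then show "u \<in> ?M" using p0 by auto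
    qed
  qed (use p0 in auto)
  have split: "{..<p ^ Suc j} = coprime_residues p j \<union> ?M" unfolding M coprime_residues_def by auto
  have "(\<Sum>u<p ^ Suc j. e ^ u) = (\<Sum>u\<in>coprime_residues p j. e ^ u) + (\<Sum>u\<in>?M. e ^ u)"
    unfolding split by (rule sum.union_disjoint) (auto simp: coprime_residues_def)
  also have "(\<Sum>u\<in>?M. e ^ u) = (\<Sum>v<p ^ j. (e ^ p) ^ v)"
    using p0 by (subst sum.reindex) (auto simp: inj_on_def power_mult)
  finally have "(\<Sum>u\<in>coprime_residues p j. e ^ u) = (\<Sum>u<p ^ Suc j. e ^ u) - (\<Sum>v<p ^ j. (e ^ p) ^ v)"
    by (simp only: add_diff_cancel_right')
  moreover have "(e ^ p) ^ (p ^ j) = 1" using e by (simp add: power_mult)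
  ultimately show ?thesis by (simp only: geometric_sum_root_of_unity[OF e] geometric_sum_root_of_unity)
qed

lemma card_coprime_residues:
  assumes "Factorial_Ring.prime p"
  shows "(of_nat (card (coprime_residues p j)) :: complex) = of_nat (p ^ j) * of_nat (p - 1)"
proof -
  have "p \<ge> 1" using prime_gt_0_nat[OF assms] by simp
  then show ?thesis
    using ramanujan_sum_prime_power[OF assms, of 1 j] by (simp add: algebra_simps of_nat_diff)
qed

lemma (in Group.group) pow_coprime_surj:
  assumes fin: "finite (carrier G)" and "Rings.coprime u (Coset.order G)"
  shows "(\<lambda>g. g [^] (u :: nat)) ` carrier G = carrier G"
proof
  show "carrier G \<subseteq> (\<lambda>g. g [^] u) ` carrier G"
  proof
    fix g assume g: "g \<in> carrier G"
    have pos: "Coset.order G > 0" using fin by (simp add: order_gt_0_iff_finite)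
    show "g \<in> (\<lambda>g. g [^] u) ` carrier G"
    proof (cases "u = 0")
      case True
      then have "Coset.order G = 1" using assms by simp
      then have "g = \<one>" using pow_order_eq_1[OF g] g by simp
      then show ?thesis using g by (intro image_eqI[of _ _ \<one>]) auto
    next
      case False
      obtain v w where "u * v = Coset.order G * w + gcd u (Coset.order G)" using bezout_nat[OF False] by blast
      then have vw: "v * u = Coset.order G * w + 1" using assms by (simp add: mult.commute)
      have "(g [^] v) [^] u = (g [^] Coset.order G) [^] w \<otimes> g"
        using g by (simp add: nat_pow_pow vw del: One_nat_def) (simp add: nat_pow_mult[symmetric])
      then have "(g [^] v) [^] u = g" using g pow_order_eq_1[OF g] by simp
      then show ?thesis using g by (intro image_eqI[of _ _ "g [^] v"]) auto
    qed
  qed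
qed auto

lemma primitive_root_exists:
  assumes p: "Factorial_Ring.prime p"
  obtains \<zeta> where "primitive_prime_power_root p j \<zeta>"
    and "\<And>e :: complex. e ^ (p ^ Suc j) = 1 \<Longrightarrow> \<exists>i. e = \<zeta> ^ i"
proof -
  let ?N = "p ^ Suc j"
  have p1: "p > 1" using p by (rule prime_gt_1_nat)
  have N: "?N > 0" using p1 by simp
  define \<zeta> where "\<zeta> = cis (2 * pi / ?N)"
  have pw: "\<zeta> ^ i = cis (2 * pi * real i / real ?N)" for i
    by (simp add: \<zeta>_def DeMoivre mult_ac)
  have bij: "bij_betw (\<lambda>i. \<zeta> ^ i) {..<?N} {z. z ^ ?N = 1}"
    unfolding pw by (rule bij_betw_roots_unity[OF N])
  have "\<zeta> ^ ?N = 1" using pw[of ?N] N by simp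
  moreover have "\<zeta> ^ (p ^ j) \<noteq> 1"
  proof
    assume "\<zeta> ^ (p ^ j) = 1"
    then have "\<zeta> ^ (p ^ j) = \<zeta> ^ 0" by simp
    moreover have "p ^ j < ?N" using p1 by simp
    ultimately have "p ^ j = 0"
      using N by (intro inj_onD[OF bij_betw_imp_inj_on[OF bij]]) auto
    then show False using p1 by simp
  qed
  moreover have "\<exists>i. e = \<zeta> ^ i" if "e ^ ?N = 1" for e
    using bij that unfolding bij_betw_def by blast
  ultimately show thesis using that by (simp add: primitive_prime_power_root_def)
qed

lemma primitive_root_power:
  assumes p: "Factorial_Ring.prime p" and \<zeta>: "primitive_prime_power_root p j \<zeta>" and u: "\<not> p dvd u"
  shows "primitive_prime_power_root p j (\<zeta> ^ u)"
  unfolding primitive_prime_power_root_def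
proof
  show "(\<zeta> ^ u) ^ p ^ Suc j = 1"
    using \<zeta> unfolding primitive_prime_power_root_def by (metis mult.commute power_mult power_one)
  show "(\<zeta> ^ u) ^ p ^ j \<noteq> 1"
  proof
    assume "(\<zeta> ^ u) ^ p ^ j = 1"
    then have "(\<zeta> ^ p ^ j) ^ u = 1" by (metis mult.commute power_mult)
    moreover have "(\<zeta> ^ p ^ j) ^ p = 1"
      using \<zeta> unfolding primitive_prime_power_root_def by (metis mult.commute power_Suc power_mult)
    moreover have "Rings.coprime u p" using prime_imp_power_coprime_nat[OF p u, of 1] by simp
    ultimately have "\<zeta> ^ p ^ j = 1" by (rule power_eq_1_coprime)
    then show False using \<zeta> by (simp add: primitive_prime_power_root_def)
  qed
qed

text \<open>The exponent is written \<open>Suc j\<close> because the maximal proper divisor \<open>p ^ j\<close> of the order enters the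
  sums below.\<close>

locale p_group_irreducible_representation = irreducible_representation +
  fixes p j :: nat
  assumes prime: "Factorial_Ring.prime p" and order_eq: "Coset.order G = p ^ Suc j"
begin

abbreviation "\<chi> \<equiv> character G \<rho>"
abbreviation "\<Gamma> \<equiv> char_galois G \<chi>"

lemma fin: "finite (carrier G)"
  using order_eq prime_gt_0_nat[OF prime] order_gt_0_iff_finite by simp

text \<open>Write each eigenvalue of \<open>g\<close> as a power of a primitive root \<open>\<zeta>\<close>.  Then \<open>\<chi>(g)\<close> is a polynomial in \<open>\<zeta>\<close>,
  and replacing \<open>\<zeta>\<close> by \<open>\<zeta> ^ u\<close> raises all eigenvalues to the power \<open>u\<close>.\<close>

lemma galois_power_map:
  assumes u: "\<not> p dvd u"
  shows "\<exists>\<tau> \<in> \<Gamma>. \<forall>g \<in> carrier G. \<tau> (\<chi> g) = \<chi> (g [^] u)"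
proof -
  obtain \<zeta> where \<zeta>: "primitive_prime_power_root p j \<zeta>"
    and roots: "\<And>e :: complex. e ^ (p ^ Suc j) = 1 \<Longrightarrow> \<exists>i. e = \<zeta> ^ i"
    using primitive_root_exists[OF prime] by blast
  have "Rings.coprime u (p ^ Suc j)" by (rule prime_imp_power_coprime_nat[OF prime u])
  then have surj: "(\<lambda>g. g [^] u) ` carrier G = carrier G"
    by (intro pow_coprime_surj[OF fin]) (simp only: order_eq)
  show ?thesis
  proof (rule cyclotomic_automorphism_restricts[OF prime \<zeta> primitive_root_power[OF prime \<zeta> u] surj])
    fix g assume g: "g \<in> carrier G"
    obtain es where es: "\<And>e. e \<in> set es \<Longrightarrow> e ^ Coset.order G = 1"
      "\<And>k :: nat. mat_trace (\<rho> (g [^] k)) = (\<Sum>e\<leftarrow>es. e ^ k)"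
      using rep_eigenvalues[OF fin g] by metis
    have "\<exists>f. qeval f \<zeta> = sum_list xs \<and> qeval f (\<zeta> ^ u) = (\<Sum>e\<leftarrow>xs. e ^ u)" if "set xs \<subseteq> set es" for xs
      using that
    proof (induction xs)
      case Nil
      show ?case by (intro exI[of _ 0]) simp
    next
      case (Cons e xs)
      then obtain f where f: "qeval f \<zeta> = sum_list xs" "qeval f (\<zeta> ^ u) = (\<Sum>e\<leftarrow>xs. e ^ u)" by auto
      obtain i where "e = \<zeta> ^ i" using roots es(1)[of e] Cons.prems order_eq by auto
      then show ?case using f
        by (intro exI[of _ "Polynomial.monom 1 i + f"]) (simp add: power_mult[symmetric] mult.commute)
    qed
    from this[of es] show "\<exists>f. qeval f \<zeta> = \<chi> g \<and> qeval f (\<zeta> ^ u) = \<chi> (g [^] u)"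
      using es(2)[of 1] es(2)[of u] g by (simp add: character_def)
  qed
qed

definition power_average :: "'a \<Rightarrow> complex" where
  "power_average g = (\<Sum>u\<in>coprime_residues p j. \<chi> (g [^] u))"

text \<open>Each eigenvalue of \<open>g\<close> contributes a Ramanujan sum, which is an integer and at least \<open>- p ^ j\<close>.\<close>

lemma power_average_bounds:
  assumes g: "g \<in> carrier G"
  shows "power_average g \<in> \<int>" and "Re (power_average g) \<ge> - (real n * real (p ^ j))"
proof -
  obtain es where es: "length es = n" "\<And>e. e \<in> set es \<Longrightarrow> e ^ Coset.order G = 1"
    "\<And>k :: nat. mat_trace (\<rho> (g [^] k)) = (\<Sum>e\<leftarrow>es. e ^ k)"
    using rep_eigenvalues[OF fin g] by metis
  define r :: "complex \<Rightarrow> int" where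
    "r e = (if e = 1 then int (p ^ Suc j) else 0) - (if e ^ p = 1 then int (p ^ j) else 0)" for e
  have r: "(\<Sum>u\<in>coprime_residues p j. e ^ u) = of_int (r e)" if "e \<in> set es" for e
    using ramanujan_sum_prime_power[OF prime, of e j] es(2)[OF that] order_eq by (simp add: r_def)
  have "power_average g = (\<Sum>u\<in>coprime_residues p j. \<Sum>e\<leftarrow>es. e ^ u)"
    using es(3) g by (simp add: power_average_def character_def)
  also have "\<dots> = (\<Sum>e\<leftarrow>es. \<Sum>u\<in>coprime_residues p j. e ^ u)"
    by (simp add: sum_list_sum_nth sum.swap[of _ "coprime_residues p j"])
  also have "\<dots> = (\<Sum>e\<leftarrow>es. of_int (r e))" using r by (intro arg_cong[of _ _ sum_list] map_cong) auto
  also have "\<dots> = of_int (\<Sum>e\<leftarrow>es. r e)" by (induction es) auto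
  finally have pa: "power_average g = of_int (\<Sum>e\<leftarrow>es. r e)" .
  then show "power_average g \<in> \<int>" by simp
  have "r e \<ge> - int (p ^ j)" for e using prime_gt_0_nat[OF prime] by (simp add: r_def)
  then have "(\<Sum>e\<leftarrow>xs. r e) \<ge> - (int (length xs) * int (p ^ j))" for xs
  proof (induction xs)
    case (Cons x xs)
    have "- int (p ^ j) \<le> r x" by (rule Cons.prems)
    moreover have "- (int (length xs) * int (p ^ j)) \<le> (\<Sum>e\<leftarrow>xs. r e)" by (rule Cons.IH[OF Cons.prems])
    ultimately show ?case by (simp add: algebra_simps)
  qed simp
  from this[of es] have "(\<Sum>e\<leftarrow>es. r e) \<ge> - (int n * int (p ^ j))" using es(1) by simp
  then have "real_of_int (\<Sum>e\<leftarrow>es. r e) \<ge> real_of_int (- (int n * int (p ^ j)))" by (simp only: of_int_le_iff)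
  then show "Re (power_average g) \<ge> - (real n * real (p ^ j))" by (simp add: pa)
qed

text \<open>The orbit sum does not change when \<open>g\<close> is replaced by \<open>g ^ u\<close>, so it may be averaged over \<open>u\<close>.  The
  averaged value is rational and therefore fixed by every automorphism.\<close>

lemma galois_orbit_sum:
  assumes g: "g \<in> carrier G"
  shows "of_nat (p ^ j) * of_nat (p - 1) * (\<Sum>\<sigma>\<in>\<Gamma>. \<sigma> (\<chi> g)) = of_nat (card \<Gamma>) * power_average g"
proof -
  have mem: "\<chi> (g [^] u) \<in> char_field G \<chi>" for u :: nat
    using value_in_char_field[of "g [^] u" G \<chi>] g by simp
  have inv: "(\<Sum>\<sigma>\<in>\<Gamma>. \<sigma> (\<chi> g)) = (\<Sum>\<sigma>\<in>\<Gamma>. \<sigma> (\<chi> (g [^] u)))" if u: "u \<in> coprime_residues p j" for u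
  proof -
    obtain \<tau> where \<tau>: "\<tau> \<in> \<Gamma>" "\<tau> (\<chi> g) = \<chi> (g [^] u)"
      using galois_power_map[of u] u g by (auto simp: coprime_residues_def)
    have "(\<Sum>\<sigma>\<in>\<Gamma>. compose (char_field G \<chi>) \<sigma> \<tau> (\<chi> g)) = (\<Sum>\<sigma>\<in>\<Gamma>. \<sigma> (\<chi> g))"
      by (rule sum.reindex_bij_betw[OF char_galois_right_translation[OF \<tau>(1)]])
    then show ?thesis using \<tau>(2) value_in_char_field[OF g, of \<chi>] by (simp add: compose_def)
  qed
  have "of_nat (p ^ j) * of_nat (p - 1) * (\<Sum>\<sigma>\<in>\<Gamma>. \<sigma> (\<chi> g)) = (\<Sum>u\<in>coprime_residues p j. \<Sum>\<sigma>\<in>\<Gamma>. \<sigma> (\<chi> g))"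
    using card_coprime_residues[OF prime, of j] by simp
  also have "\<dots> = (\<Sum>u\<in>coprime_residues p j. \<Sum>\<sigma>\<in>\<Gamma>. \<sigma> (\<chi> (g [^] u)))"
    by (rule sum.cong[OF refl inv])
  also have "\<dots> = (\<Sum>\<sigma>\<in>\<Gamma>. \<Sum>u\<in>coprime_residues p j. \<sigma> (\<chi> (g [^] u)))" by (rule sum.swap)
  also have "\<dots> = (\<Sum>\<sigma>\<in>\<Gamma>. \<sigma> (power_average g))"
    unfolding power_average_def
    by (rule sum.cong[OF refl], rule char_galois_sum[of _ G \<chi> _ "\<lambda>u. \<chi> (g [^] u)", OF _ mem, symmetric])
  also have "\<dots> = (\<Sum>\<sigma>\<in>\<Gamma>. power_average g)"
  proof (rule sum.cong[OF refl])
    fix \<sigma> assume "\<sigma> \<in> \<Gamma>"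
    moreover have "power_average g \<in> \<rat>" using power_average_bounds(1)[OF g] Ints_subset_Rats by blast
    ultimately show "\<sigma> (power_average g) = power_average g" by (simp add: char_galois_iff)
  qed
  finally show ?thesis by simp
qed

lemma galois_orbit_sum_lower_bound:
  assumes g: "g \<in> carrier G"
  shows "Re (\<Sum>\<sigma>\<in>\<Gamma>. \<sigma> (\<chi> g)) \<ge> - (real n * real (card \<Gamma>) / real (p - 1))"
proof -
  let ?T = "\<Sum>\<sigma>\<in>\<Gamma>. \<sigma> (\<chi> g)"
  have pos: "real (p ^ j) > 0" "real (p - 1) > 0"
    using prime_gt_1_nat[OF prime] by simp_all
  have "real (p ^ j) * real (p - 1) * Re ?T = Re (of_real (real (p ^ j) * real (p - 1)) * ?T)"
    by (simp only: Re_complex_of_real Im_complex_of_real times_complex.simps mult_zero_left diff_zero)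
  also have "\<dots> = Re (of_real (real (card \<Gamma>)) * power_average g)"
    using galois_orbit_sum[OF g] by simp
  also have "\<dots> = real (card \<Gamma>) * Re (power_average g)" by simp
  also have "\<dots> \<ge> real (card \<Gamma>) * - (real n * real (p ^ j))"
    using power_average_bounds(2)[OF g] by (intro mult_left_mono) auto
  finally have "real (p ^ j) * (real (p - 1) * Re ?T) \<ge> real (p ^ j) * - (real n * real (card \<Gamma>))"
    by (simp add: algebra_simps)
  then have "real (p - 1) * Re ?T \<ge> - (real n * real (card \<Gamma>))" using pos by (simp only: mult_le_cancel_left_pos)
  then show ?thesis using pos by (simp add: field_simps)
qed

lemma galois_orbit_sum_one: "(\<Sum>\<sigma>\<in>\<Gamma>. \<sigma> (\<chi> \<one>)) = of_nat (n * card \<Gamma>)"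
proof -
  have "\<chi> \<one> = of_nat n" using trace_one by (simp add: character_def)
  moreover have "\<sigma> (of_nat n) = of_nat n" if "\<sigma> \<in> \<Gamma>" for \<sigma> using that by (simp add: char_galois_iff)
  ultimately have "(\<Sum>\<sigma>\<in>\<Gamma>. \<sigma> (\<chi> \<one>)) = (\<Sum>\<sigma>\<in>\<Gamma>. of_nat n)" by (intro sum.cong) auto
  then show ?thesis by simp
qed

context
  fixes z
  assumes z: "z \<in> group_center G" "z [^] p = \<one>" "z \<notin> char_kernel G \<chi>"
begin

lemma central_character_value:
  obtains \<omega> where "\<omega> ^ p = 1" "\<omega> \<noteq> 1" "\<And>u :: nat. \<chi> (z [^] u) = of_nat n * \<omega> ^ u"
proof -
  have zG: "z \<in> carrier G" using z by (simp add: group_center_def)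
  obtain c where c: "\<rho> z = c \<cdot>\<^sub>m 1\<^sub>m n" using central_scalar[OF z(1)] by blast
  have pw: "\<rho> (z [^] u) = c ^ u \<cdot>\<^sub>m 1\<^sub>m n" for u :: nat
  proof (induction u)
    case 0
    show ?case by (rule eq_matI) (auto simp: rep_one)
  next
    case (Suc u)
    have "\<rho> (z [^] Suc u) = \<rho> (z [^] u) * \<rho> z" using zG by (simp add: rep_mult)
    also have "\<dots> = c ^ Suc u \<cdot>\<^sub>m 1\<^sub>m n" unfolding Suc c by (rule eq_matI) (auto simp: mult.commute)
    finally show ?case .
  qed
  have "c ^ p = 1"
    using arg_cong[OF pw[of p], of "\<lambda>A. A $$ (0, 0)"] degree_pos by (simp add: z rep_one)
  moreover have "c \<noteq> 1"
  proof
    assume "c = 1"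
    then have "\<rho> z = 1\<^sub>m n" unfolding c by (intro eq_matI) auto
    then show False using z(3) zG by (simp add: char_kernel_eq[OF fin])
  qed
  moreover have "\<chi> (z [^] u) = of_nat n * c ^ u" for u :: nat
    using zG by (simp add: character_def pw mat_trace_def)
  ultimately show thesis using that by blast
qed

text \<open>The lower bound of \<open>galois_orbit_sum_lower_bound\<close> is attained: all eigenvalues of \<open>z\<close> equal one
  primitive \<open>p\<close>-th root of unity, which makes every Ramanujan sum as small as possible.\<close>

lemma galois_orbit_sum_central:
  "(\<Sum>\<sigma>\<in>\<Gamma>. \<sigma> (\<chi> z)) = - of_real (real n * real (card \<Gamma>) / real (p - 1))"
proof -
  have zG: "z \<in> carrier G" using z by (simp add: group_center_def)
  obtain \<omega> where \<omega>: "\<omega> ^ p = 1" "\<omega> \<noteq> 1" "\<And>u :: nat. \<chi> (z [^] u) = of_nat n * \<omega> ^ u"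
    using central_character_value by blast
  have "\<omega> ^ (p ^ Suc j) = 1" using \<omega>(1) by (simp add: power_mult)
  from ramanujan_sum_prime_power[OF prime this] have "power_average z = - (of_nat n * of_nat (p ^ j))"
    using \<omega> by (simp add: power_average_def sum_distrib_left[symmetric])
  then have "of_nat (p ^ j) * (of_nat (p - 1) * (\<Sum>\<sigma>\<in>\<Gamma>. \<sigma> (\<chi> z))) = (of_nat (p ^ j) :: complex) * - (of_nat n * of_nat (card \<Gamma>))"
    using galois_orbit_sum[OF zG] by (simp add: algebra_simps)
  moreover have "(of_nat (p ^ j) :: complex) \<noteq> 0" "(of_nat (p - 1) :: complex) \<noteq> 0"
    using prime_gt_1_nat[OF prime] by simp_all
  ultimately have "of_nat (p - 1) * (\<Sum>\<sigma>\<in>\<Gamma>. \<sigma> (\<chi> z)) = - (of_nat n * of_nat (card \<Gamma>))"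
    by (simp only: mult_cancel_left) simp
  then show ?thesis using \<open>(of_nat (p - 1) :: complex) \<noteq> 0\<close> by (simp add: field_simps)
qed

lemma prime_minus_one_dvd_card_galois: "p - 1 dvd card \<Gamma>"
proof -
  have zG: "z \<in> carrier G" using z by (simp add: group_center_def)
  obtain \<omega> where \<omega>: "\<omega> ^ p = 1" "\<omega> \<noteq> 1" "\<And>u :: nat. \<chi> (z [^] u) = of_nat n * \<omega> ^ u"
    using central_character_value by blast
  have n0: "(of_nat n :: complex) \<noteq> 0" using degree_pos by simp
  have \<omega>z: "\<chi> z = of_nat n * \<omega>" using \<omega>(3)[of 1] zG by simp
  have nK: "of_nat n \<in> char_field G \<chi>" using Rats_subset_char_field by (rule subsetD) simp
  have "\<omega> = inverse (of_nat n) * \<chi> z" using \<omega>z n0 by simp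
  moreover have "inverse (of_nat n) * \<chi> z \<in> char_field G \<chi>"
    using nK n0 value_in_char_field[OF zG, of \<chi>] unfolding char_field_def
    by (intro generate_field_class_ring_intros(4,6))
  ultimately have \<omega>K: "\<omega> \<in> char_field G \<chi>" by simp
  show ?thesis
  proof (rule prime_minus_one_dvd_card_char_galois[OF prime \<omega>(1,2) \<omega>K])
    fix u assume "\<not> p dvd u"
    then obtain \<tau> where \<tau>: "\<tau> \<in> \<Gamma>" "\<tau> (\<chi> z) = \<chi> (z [^] u)" using galois_power_map zG by blast
    have "\<tau> (of_nat n * \<omega>) = of_nat n * \<tau> \<omega>"
      using \<tau>(1) nK \<omega>K by (simp add: char_galois_iff)
    then have "of_nat n * \<tau> \<omega> = of_nat n * \<omega> ^ u" using \<tau>(2) \<omega>z \<omega>(3) by simp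
    then have "\<tau> \<omega> = \<omega> ^ u" using n0 by simp
    then show "\<exists>\<tau>\<in>\<Gamma>. \<tau> \<omega> = \<omega> ^ u" using \<tau>(1) by blast
  qed
qed

end

end

section \<open>Minimal faithful sets of characters\<close>

lemma Irr_obtain_representation:
  assumes "Group.group G" "\<chi> \<in> Irr G"
  obtains n \<rho> where "irreducible_representation G n \<rho>" "\<chi> = character G \<rho>"
  using assms irreducible_representationI[OF assms(1)] unfolding Irr_def by blast

lemma Irr_degree:
  assumes "Group.group G" "finite (carrier G)" "\<chi> \<in> Irr G"
  obtains n where "\<chi> \<one>\<^bsub>G\<^esub> = of_nat n" "n dvd Coset.order G"
proof -
  obtain n \<rho> where irr: "irreducible_representation G n \<rho>" and \<chi>: "\<chi> = character G \<rho>"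
    using Irr_obtain_representation[OF assms(1,3)] by blast
  interpret irreducible_representation G n \<rho> by (rule irr)
  show thesis
    by (rule that[of n]) (use trace_one degree_dvd_order[OF assms(2)] in \<open>simp_all add: \<chi> character_def\<close>)
qed

lemma Irr_kernel_normal:
  assumes "Group.group G" "finite (carrier G)" "\<chi> \<in> Irr G"
  shows "char_kernel G \<chi> \<lhd> G"
proof -
  obtain n \<rho> where irr: "irreducible_representation G n \<rho>" and \<chi>: "\<chi> = character G \<rho>"
    using Irr_obtain_representation[OF assms(1,3)] by blast
  interpret irreducible_representation G n \<rho> by (rule irr)
  show ?thesis unfolding \<chi> by (rule char_kernel_normal[OF assms(2)])
qed

lemma common_kernel_normal:
  assumes G: "Group.group G" and fin: "finite (carrier G)" and C: "C \<subseteq> Irr G"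
  shows "common_kernel G C \<lhd> G"
proof -
  interpret Group.group G by (rule G)
  have N: "char_kernel G \<chi> \<lhd> G" if "\<chi> \<in> C" for \<chi> using Irr_kernel_normal[OF G fin] C that by blast
  have S: "subgroup (char_kernel G \<chi>) G" if "\<chi> \<in> C" for \<chi> using N[OF that] by (rule normal_imp_subgroup)
  have mem: "g \<in> common_kernel G C \<longleftrightarrow> g \<in> carrier G \<and> (\<forall>\<chi>\<in>C. g \<in> char_kernel G \<chi>)" for g
    by (auto simp: common_kernel_def)
  have "subgroup (common_kernel G C) G"
  proof (rule subgroupI)
    show "common_kernel G C \<subseteq> carrier G" by (auto simp: mem)
    have "\<one>\<^bsub>G\<^esub> \<in> common_kernel G C" unfolding mem using S subgroup.one_closed by auto
    then show "common_kernel G C \<noteq> {}" by blast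
    show "inv\<^bsub>G\<^esub> a \<in> common_kernel G C" if "a \<in> common_kernel G C" for a
      using that S unfolding mem by (simp add: subgroup.m_inv_closed)
    show "a \<otimes>\<^bsub>G\<^esub> b \<in> common_kernel G C" if "a \<in> common_kernel G C" "b \<in> common_kernel G C" for a b
      using that S unfolding mem by (simp add: subgroup.m_closed)
  qed
  moreover have "x \<otimes>\<^bsub>G\<^esub> h \<otimes>\<^bsub>G\<^esub> inv\<^bsub>G\<^esub> x \<in> common_kernel G C" if "x \<in> carrier G" "h \<in> common_kernel G C" for x h
    using that N unfolding mem by (simp add: normal.inv_op_closed2)
  ultimately show ?thesis unfolding normal_inv_iff by blast
qed

text \<open>Matrices of size one commute.\<close>

lemma derived_subset_linear_kernel:
  assumes G: "Group.group G" and fin: "finite (carrier G)" and \<chi>: "\<chi> \<in> lin G"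
  shows "derived G (carrier G) \<subseteq> char_kernel G \<chi>"
proof -
  have I: "\<chi> \<in> Irr G" and one: "\<chi> \<one>\<^bsub>G\<^esub> = 1" using \<chi> by (auto simp: lin_def)
  obtain n \<rho> where irr: "irreducible_representation G n \<rho>" and \<chi>: "\<chi> = character G \<rho>"
    using Irr_obtain_representation[OF G I] by blast
  interpret irreducible_representation G n \<rho> by (rule irr)
  have n: "n = 1" using one trace_one by (simp add: \<chi> character_def)
  have comm: "\<rho> a * \<rho> b = \<rho> b * \<rho> a" if "a \<in> carrier G" "b \<in> carrier G" for a b
    using rep_carrier[OF that(1)] rep_carrier[OF that(2)] unfolding n
    by (intro eq_matI) (auto simp: scalar_prod_def mult.commute)
  have K: "subgroup (char_kernel G \<chi>) G"
    unfolding \<chi> using char_kernel_normal[OF fin] by (rule normal_imp_subgroup)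
  have "h1 \<otimes>\<^bsub>G\<^esub> h2 \<otimes>\<^bsub>G\<^esub> inv\<^bsub>G\<^esub> h1 \<otimes>\<^bsub>G\<^esub> inv\<^bsub>G\<^esub> h2 \<in> char_kernel G \<chi>" if h: "h1 \<in> carrier G" "h2 \<in> carrier G" for h1 h2
  proof -
    have "\<rho> (h1 \<otimes>\<^bsub>G\<^esub> h2 \<otimes>\<^bsub>G\<^esub> inv\<^bsub>G\<^esub> h1 \<otimes>\<^bsub>G\<^esub> inv\<^bsub>G\<^esub> h2) = \<rho> (h1 \<otimes>\<^bsub>G\<^esub> h2) * \<rho> (inv\<^bsub>G\<^esub> h1 \<otimes>\<^bsub>G\<^esub> inv\<^bsub>G\<^esub> h2)"
      using h by (simp add: rep_mult[symmetric] m_assoc)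
    also have "\<rho> (h1 \<otimes>\<^bsub>G\<^esub> h2) = \<rho> (h2 \<otimes>\<^bsub>G\<^esub> h1)" using h comm by (simp add: rep_mult)
    also have "\<dots> * \<rho> (inv\<^bsub>G\<^esub> h1 \<otimes>\<^bsub>G\<^esub> inv\<^bsub>G\<^esub> h2) = \<rho> ((h2 \<otimes>\<^bsub>G\<^esub> h1) \<otimes>\<^bsub>G\<^esub> inv\<^bsub>G\<^esub> (h2 \<otimes>\<^bsub>G\<^esub> h1))"
      using h by (simp add: rep_mult[symmetric] inv_mult_group del: r_inv)
    also have "\<dots> = 1\<^sub>m n" using h by (simp add: rep_one)
    finally show ?thesis using h by (simp add: \<chi> char_kernel_eq[OF fin])
  qed
  then show ?thesis unfolding derived_def by (intro generate_subgroup_incl[OF _ K]) blast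
qed

text \<open>Minimality provides for each \<open>\<chi>\<close> a central element with trivial \<open>p\<close>-th power that lies outside the
  kernel of \<open>\<chi>\<close> but inside all other kernels.  The product of such elements over a subset \<open>F\<close> lies
  outside exactly the kernels of the members of \<open>F\<close>.\<close>

lemma (in Group.group) separating_central_element:
  assumes p: "Factorial_Ring.prime p" and fin: "finite (carrier G)" and ord: "Coset.order G = p ^ k"
    and C: "C \<subseteq> Irr G" "finite C" and triv: "common_kernel G C = {\<one>}"
    and minimal: "\<forall>Y. Y \<subset> C \<longrightarrow> common_kernel G Y \<noteq> {\<one>}"
  obtains z where "z \<in> group_center G" "z [^] p = \<one>" "\<And>\<chi>. \<chi> \<in> C \<Longrightarrow> z \<notin> char_kernel G \<chi>"
proof -
  have S: "subgroup (char_kernel G \<chi>) G" if "\<chi> \<in> C" for \<chi>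
    using Irr_kernel_normal[OF group_axioms fin] C that normal_imp_subgroup by blast
  have Z: "subgroup (group_center G) G" by (rule subgroup_group_center)
  have single: "\<exists>z. z \<in> group_center G \<and> z [^] p = \<one> \<and> z \<notin> char_kernel G \<chi> \<and> (\<forall>\<psi>\<in>C. \<psi> \<noteq> \<chi> \<longrightarrow> z \<in> char_kernel G \<psi>)"
    if \<chi>: "\<chi> \<in> C" for \<chi>
  proof -
    have "C - {\<chi>} \<subset> C" using \<chi> by blast
    then have nt: "common_kernel G (C - {\<chi>}) \<noteq> {\<one>}" using minimal by blast
    have nor: "common_kernel G (C - {\<chi>}) \<lhd> G" using C by (intro common_kernel_normal[OF group_axioms fin]) auto
    obtain z where z: "z \<in> common_kernel G (C - {\<chi>})" "z \<in> group_center G" "z \<noteq> \<one>" "z [^] p = \<one>"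
      using p_group_normal_central_order_p[OF p fin ord nor nt] by blast
    have "z \<notin> common_kernel G C" using triv z by simp
    then have "z \<notin> char_kernel G \<chi>" using z by (auto simp: common_kernel_def)
    then show ?thesis using z by (auto simp: common_kernel_def)
  qed
  have "\<exists>z. z \<in> group_center G \<and> z [^] p = \<one> \<and> (\<forall>\<chi>\<in>C. z \<in> char_kernel G \<chi> \<longleftrightarrow> \<chi> \<notin> F)"
    if "finite F" "F \<subseteq> C" for F
    using that
  proof (induction F)
    case empty
    show ?case using S subgroup.one_closed[OF Z] by (intro exI[of _ \<one>]) (auto simp: subgroup.one_closed)
  next
    case (insert \<chi> F)
    then obtain z where z: "z \<in> group_center G" "z [^] p = \<one>" "\<forall>\<chi>\<in>C. z \<in> char_kernel G \<chi> \<longleftrightarrow> \<chi> \<notin> F" by blast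
    obtain w where w: "w \<in> group_center G" "w [^] p = \<one>" "w \<notin> char_kernel G \<chi>" "\<forall>\<psi>\<in>C. \<psi> \<noteq> \<chi> \<longrightarrow> w \<in> char_kernel G \<psi>"
      using single[of \<chi>] insert.prems by blast
    have G: "z \<in> carrier G" "w \<in> carrier G" using z w by (auto simp: group_center_def)
    have zw: "z \<otimes> w = w \<otimes> z" using z(1) G by (simp add: group_center_def)
    have cancel: "z \<otimes> w \<in> K \<longleftrightarrow> w \<in> K" if "subgroup K G" "z \<in> K" for K
    proof
      assume "z \<otimes> w \<in> K"
      then have "inv z \<otimes> (z \<otimes> w) \<in> K" using that by (simp add: subgroup.m_closed subgroup.m_inv_closed)
      then show "w \<in> K" using G by (simp add: m_assoc[symmetric])
    qed (use that in \<open>simp add: subgroup.m_closed\<close>)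
    have cancel': "z \<otimes> w \<in> K \<longleftrightarrow> z \<in> K" if "subgroup K G" "w \<in> K" for K
    proof
      assume "z \<otimes> w \<in> K"
      then have "(z \<otimes> w) \<otimes> inv w \<in> K" using that by (simp add: subgroup.m_closed subgroup.m_inv_closed)
      then show "z \<in> K" using G by (simp add: m_assoc)
    qed (use that in \<open>simp add: subgroup.m_closed\<close>)
    have "z \<otimes> w \<in> char_kernel G \<psi> \<longleftrightarrow> \<psi> \<notin> insert \<chi> F" if \<psi>: "\<psi> \<in> C" for \<psi>
    proof (cases "\<psi> = \<chi>")
      case True
      then show ?thesis using cancel[OF S[OF \<psi>]] z(3) w(3) \<psi> insert.hyps by auto
    next
      case False
      then show ?thesis using cancel'[OF S[OF \<psi>]] z(3) w(4) \<psi> by auto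
    qed
    moreover have "(z \<otimes> w) [^] p = \<one>" using pow_mult_distrib[OF zw G] z w by simp
    moreover have "z \<otimes> w \<in> group_center G" using z w Z by (simp add: subgroup.m_closed)
    ultimately show ?case by blast
  qed
  from this[OF C(2) subset_refl] show thesis using that by blast
qed

text \<open>Choosing for each nontrivial group element one character that does not have it in its kernel gives a
  finite faithful subset, which by minimality is the whole set.\<close>

lemma minimal_faithful_finite:
  assumes fin: "finite (carrier G)" and triv: "common_kernel G C = {\<one>\<^bsub>G\<^esub>}"
    and minimal: "\<forall>Y. Y \<subset> C \<longrightarrow> common_kernel G Y \<noteq> {\<one>\<^bsub>G\<^esub>}"
  shows "finite C"
proof -
  have "\<exists>\<chi>. \<chi> \<in> C \<and> g \<notin> char_kernel G \<chi>" if "g \<in> carrier G - {\<one>\<^bsub>G\<^esub>}" for g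
    using triv that by (auto simp: common_kernel_def)
  then obtain f where f: "\<And>g. g \<in> carrier G - {\<one>\<^bsub>G\<^esub>} \<Longrightarrow> f g \<in> C \<and> g \<notin> char_kernel G (f g)" by metis
  let ?Y = "f ` (carrier G - {\<one>\<^bsub>G\<^esub>})"
  have "?Y \<subseteq> C" using f by blast
  moreover have "common_kernel G ?Y \<subseteq> {\<one>\<^bsub>G\<^esub>}" using f by (auto simp: common_kernel_def)
  moreover have "common_kernel G C \<subseteq> common_kernel G ?Y" using \<open>?Y \<subseteq> C\<close> by (auto simp: common_kernel_def)
  ultimately have "?Y = C" using triv minimal by (metis psubsetI subset_antisym)
  moreover have "finite ?Y" using fin by simp
  ultimately show ?thesis by metis
qed

theorem theorem2:
  fixes G :: "('a, 'b) monoid_scheme" and p :: nat and XG :: "('a \<Rightarrow> complex) set"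
  assumes "Factorial_Ring.prime p"
    and "group G" and "finite (carrier G)" and "\<exists>k. Coset.order G = p ^ k"
    and "\<not> comm_group G"
    and "min_generators (G\<lparr>carrier := group_center G \<inter> derived G (carrier G)\<rparr>)
           = min_generators (G\<lparr>carrier := group_center G\<rparr>)"
    and "min_faithful_quasi_perm G XG"
  shows "XG \<inter> lin G = {} \<and>
         (\<exists>s. p ^ s = Min {d :: nat. \<exists>\<chi> \<in> nl G. \<chi> \<one>\<^bsub>G\<^esub> = of_nat d} \<and>
              p ^ (s + 1) dvd min_quasi_perm_degree G)"
proof -
  note p = assms(1) and G = assms(2) and fin = assms(3)
  interpret Group.group G by (rule G)
  obtain k where ord: "Coset.order G = p ^ k" using assms(4) by blast
  have C: "XG \<subseteq> Irr G" and triv: "common_kernel G XG = {\<one>\<^bsub>G\<^esub>}"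
    and minimal: "\<forall>Y. Y \<subset> XG \<longrightarrow> common_kernel G Y \<noteq> {\<one>\<^bsub>G\<^esub>}"
    and deg: "of_nat (min_quasi_perm_degree G) = xi G XG \<one>\<^bsub>G\<^esub> + of_real (xi_min G XG)"
    using assms(7) by (auto simp: min_faithful_quasi_perm_def)
  have p1: "p > 1" using p by (rule prime_gt_1_nat)
  have nontriv: "carrier G \<noteq> {\<one>\<^bsub>G\<^esub>}"
  proof
    assume "carrier G = {\<one>\<^bsub>G\<^esub>}"
    then have "comm_group G" by (intro group_comm_groupI) auto
    then show False using assms(5) by simp
  qed
  have "k \<noteq> 0"
  proof
    assume "k = 0"
    then have "card (carrier G) = 1" using ord by (simp add: Coset.order_def)
    then show False using nontriv one_closed by (metis card_1_singletonE singletonD)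
  qed
  then obtain j where k: "k = Suc j" by (cases k) auto
  have finX: "finite XG" by (rule minimal_faithful_finite[OF fin triv minimal])
  \<comment> \<open>Without a linear character the rest of the set would still be faithful: a nontrivial common
    kernel would contain a central element of order p, and all of these lie in the derived subgroup.\<close>
  have nolin: "XG \<inter> lin G = {}"
  proof (rule ccontr)
    assume "XG \<inter> lin G \<noteq> {}"
    then obtain \<chi> where \<chi>: "\<chi> \<in> XG" "\<chi> \<in> lin G" by blast
    have "XG - {\<chi>} \<subset> XG" using \<chi> by blast
    then have nt: "common_kernel G (XG - {\<chi>}) \<noteq> {\<one>\<^bsub>G\<^esub>}" using minimal by blast
    have nor: "common_kernel G (XG - {\<chi>}) \<lhd> G" using C by (intro common_kernel_normal[OF G fin]) auto
    obtain z where z: "z \<in> common_kernel G (XG - {\<chi>})" "z \<in> group_center G" "z \<noteq> \<one>\<^bsub>G\<^esub>" "z [^]\<^bsub>G\<^esub> p = \<one>\<^bsub>G\<^esub>"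
      using p_group_normal_central_order_p[OF p fin ord nor nt] by blast
    have "z \<in> char_kernel G \<chi>"
      using central_torsion_subset_derived[OF p fin ord assms(6) z(2,4)] derived_subset_linear_kernel[OF G fin \<chi>(2)] by blast
    then have "z \<in> common_kernel G XG" using z(1) by (auto simp: common_kernel_def)
    then show False using triv z(3) by simp
  qed
  obtain z where z: "z \<in> group_center G" "z [^]\<^bsub>G\<^esub> p = \<one>\<^bsub>G\<^esub>" "\<And>\<chi>. \<chi> \<in> XG \<Longrightarrow> z \<notin> char_kernel G \<chi>"
    using separating_central_element[OF p fin ord C finX triv minimal] by blast
  have zG: "z \<in> carrier G" using z by (simp add: group_center_def)
  let ?\<Gamma> = "\<lambda>\<chi>. card (char_galois G \<chi>)" and ?T = "\<lambda>\<chi> g. \<Sum>\<sigma>\<in>char_galois G \<chi>. \<sigma> (\<chi> g)"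
  have facts: "\<exists>n. \<chi> \<one>\<^bsub>G\<^esub> = of_nat n \<and> p - 1 dvd ?\<Gamma> \<chi> \<and>
      ?T \<chi> \<one>\<^bsub>G\<^esub> = of_nat (n * ?\<Gamma> \<chi>) \<and> ?T \<chi> z = - of_real (real n * real (?\<Gamma> \<chi>) / real (p - 1)) \<and>
      (\<forall>g\<in>carrier G. Re (?T \<chi> g) \<ge> - (real n * real (?\<Gamma> \<chi>) / real (p - 1)))" if \<chi>C: "\<chi> \<in> XG" for \<chi>
  proof -
    obtain n \<rho> where irr: "irreducible_representation G n \<rho>" and \<chi>: "\<chi> = character G \<rho>"
      using Irr_obtain_representation[OF G] C \<chi>C by blast
    interpret P: p_group_irreducible_representation G n \<rho> p j
      using irr p ord by (intro p_group_irreducible_representation.intro p_group_irreducible_representation_axioms.intro) (simp_all add: k)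
    note z' = z(1,2) z(3)[OF \<chi>C, unfolded \<chi>]
    show ?thesis unfolding \<chi>
      using P.prime_minus_one_dvd_card_galois[OF z'] P.galois_orbit_sum_central[OF z'] P.galois_orbit_sum_one
        P.galois_orbit_sum_lower_bound P.trace_one
      by (intro exI[of _ n]) (auto simp: character_def[of G \<rho>])
  qed
  obtain n where "\<forall>\<chi>\<in>XG. \<chi> \<one>\<^bsub>G\<^esub> = of_nat (n \<chi>) \<and> p - 1 dvd ?\<Gamma> \<chi> \<and>
      ?T \<chi> \<one>\<^bsub>G\<^esub> = of_nat (n \<chi> * ?\<Gamma> \<chi>) \<and> ?T \<chi> z = - of_real (real (n \<chi>) * real (?\<Gamma> \<chi>) / real (p - 1)) \<and>
      (\<forall>g\<in>carrier G. Re (?T \<chi> g) \<ge> - (real (n \<chi>) * real (?\<Gamma> \<chi>) / real (p - 1)))"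
    using bchoice[OF ballI[OF facts]] by (rule exE)
  then have n: "\<And>\<chi>. \<chi> \<in> XG \<Longrightarrow> \<chi> \<one>\<^bsub>G\<^esub> = of_nat (n \<chi>)"
    and dvd\<Gamma>: "\<And>\<chi>. \<chi> \<in> XG \<Longrightarrow> p - 1 dvd ?\<Gamma> \<chi>"
    and T1: "\<And>\<chi>. \<chi> \<in> XG \<Longrightarrow> ?T \<chi> \<one>\<^bsub>G\<^esub> = of_nat (n \<chi> * ?\<Gamma> \<chi>)"
    and Tz: "\<And>\<chi>. \<chi> \<in> XG \<Longrightarrow> ?T \<chi> z = - of_real (real (n \<chi>) * real (?\<Gamma> \<chi>) / real (p - 1))"
    and Tg: "\<And>\<chi> g. \<chi> \<in> XG \<Longrightarrow> g \<in> carrier G \<Longrightarrow> Re (?T \<chi> g) \<ge> - (real (n \<chi>) * real (?\<Gamma> \<chi>) / real (p - 1))"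
    by (simp_all del: of_nat_mult of_real_divide of_real_mult)
  define m where "m \<chi> = ?\<Gamma> \<chi> div (p - 1)" for \<chi>
  have m: "?\<Gamma> \<chi> = (p - 1) * m \<chi>" if "\<chi> \<in> XG" for \<chi> using dvd\<Gamma>[OF that] by (simp add: m_def)
  have pr: "real (p - 1) > 0" using p1 by simp
  define W where "W = (\<Sum>\<chi>\<in>XG. n \<chi> * m \<chi>)"
  have quot: "real (n \<chi>) * real (?\<Gamma> \<chi>) / real (p - 1) = real (n \<chi> * m \<chi>)" if "\<chi> \<in> XG" for \<chi>
    using m[OF that] pr by simp
  \<comment> \<open>W is the common value of \<open>\<xi>(1) / (p - 1)\<close> and of \<open>m(\<xi>)\<close>.\<close>
  have xi1: "xi G XG \<one>\<^bsub>G\<^esub> = of_nat ((p - 1) * W)"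
  proof -
    have "xi G XG \<one>\<^bsub>G\<^esub> = (\<Sum>\<chi>\<in>XG. of_nat (n \<chi> * ?\<Gamma> \<chi>))" unfolding xi_def by (rule sum.cong[OF refl T1])
    also have "\<dots> = of_nat (\<Sum>\<chi>\<in>XG. n \<chi> * ?\<Gamma> \<chi>)" by simp
    also have "(\<Sum>\<chi>\<in>XG. n \<chi> * ?\<Gamma> \<chi>) = (p - 1) * W"
      unfolding W_def sum_distrib_left by (intro sum.cong refl) (simp add: m)
    finally show ?thesis .
  qed
  have xiz: "Re (xi G XG z) = - real W"
  proof -
    have "Re (xi G XG z) = (\<Sum>\<chi>\<in>XG. Re (?T \<chi> z))" by (simp add: xi_def)
    also have "\<dots> = (\<Sum>\<chi>\<in>XG. - real (n \<chi> * m \<chi>))"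
    proof (rule sum.cong[OF refl])
      fix \<chi> assume \<chi>: "\<chi> \<in> XG"
      show "Re (?T \<chi> z) = - real (n \<chi> * m \<chi>)" unfolding Tz[OF \<chi>] quot[OF \<chi>] by simp
    qed
    also have "\<dots> = - real W" by (simp add: W_def sum_negf)
    finally show ?thesis .
  qed
  have xig: "Re (xi G XG g) \<ge> - real W" if g: "g \<in> carrier G" for g
  proof -
    have "- real W = (\<Sum>\<chi>\<in>XG. - real (n \<chi> * m \<chi>))" by (simp add: W_def sum_negf)
    also have "\<dots> \<le> (\<Sum>\<chi>\<in>XG. Re (?T \<chi> g))"
    proof (rule sum_mono)
      fix \<chi> assume \<chi>: "\<chi> \<in> XG"
      show "- real (n \<chi> * m \<chi>) \<le> Re (?T \<chi> g)" using Tg[OF \<chi> g] unfolding quot[OF \<chi>] .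
    qed
    also have "\<dots> = Re (xi G XG g)" by (simp add: xi_def)
    finally show ?thesis .
  qed
  have "Min ((\<lambda>g. Re (xi G XG g)) ` carrier G) = - real W"
  proof (rule Min_eqI)
    show "- real W \<in> (\<lambda>g. Re (xi G XG g)) ` carrier G" using xiz zG by (intro image_eqI[of _ _ z]) simp_all
  qed (use fin xig in auto)
  then have "xi_min G XG = real W" by (simp add: xi_min_def)
  then have "(of_nat (min_quasi_perm_degree G) :: complex) = of_nat ((p - 1) * W + W)" using deg xi1 by simp
  then have "min_quasi_perm_degree G = (p - 1) * W + W" by (simp only: of_nat_eq_iff)
  also have "\<dots> = p * W" using p1 by (cases p) auto
  finally have c: "min_quasi_perm_degree G = p * W" .
  let ?D = "{d :: nat. \<exists>\<chi> \<in> nl G. \<chi> \<one>\<^bsub>G\<^esub> = of_nat d}"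
  have D: "d dvd p ^ k" if "d \<in> ?D" for d
  proof -
    obtain \<chi> where \<chi>: "\<chi> \<in> Irr G" "\<chi> \<one>\<^bsub>G\<^esub> = of_nat d" using \<open>d \<in> ?D\<close> by (auto simp: nl_def)
    obtain n' where "\<chi> \<one>\<^bsub>G\<^esub> = of_nat n'" "n' dvd Coset.order G" using Irr_degree[OF G fin \<chi>(1)] by blast
    then show ?thesis using \<chi>(2) ord by simp
  qed
  have nD: "n \<chi> \<in> ?D" if "\<chi> \<in> XG" for \<chi>
    using n[OF that] that nolin C by (auto simp: nl_def lin_def)
  have "XG \<noteq> {}" using triv nontriv by (auto simp: common_kernel_def)
  then have neD: "?D \<noteq> {}" using nD by blast
  have finD: "finite ?D"
  proof (rule finite_subset)
    show "?D \<subseteq> {..p ^ k}" using D p1 by (auto intro!: dvd_imp_le)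
  qed simp
  have "Min ?D \<in> ?D" by (rule Min_in[OF finD neD])
  then have "Min ?D dvd p ^ k" by (rule D)
  then obtain s where s: "Min ?D = p ^ s" by (auto simp: divides_primepow_nat[OF p])
  have "p ^ s dvd n \<chi>" if \<chi>: "\<chi> \<in> XG" for \<chi>
  proof -
    obtain i where i: "n \<chi> = p ^ i" using D[OF nD[OF \<chi>]] by (auto simp: divides_primepow_nat[OF p])
    have "p ^ s \<le> p ^ i" using Min_le[OF finD nD[OF \<chi>]] unfolding s i .
    then have "s \<le> i" by (rule power_le_imp_le_exp[OF p1])
    then show ?thesis unfolding i by (rule le_imp_power_dvd)
  qed
  then have "p ^ s dvd W" unfolding W_def by (intro dvd_sum dvd_mult2)
  then have "p ^ (s + 1) dvd min_quasi_perm_degree G" unfolding c by simp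
  then show ?thesis using nolin s by metis
qed

end
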